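(* Let $G$ be a marked group, and for $l\ge1$ let $T^l(G)$ be the decomposition tree of $G$ with offset $l$. The following are equivalent: (1) $G$ is elementary amenable. (2) $T^l(G)$ is well-founded for all $l\geq 1$. (3) $T^l(G)$ is well-founded for some $l\geq 1$.
   Context: Marked groups. Let $\mathbb{F}_\omega$ be the free group on letters $(a_i)_{i\in\mathbb{N}}$, with a fixed enumeration $(\gamma_i)_{i\in\mathbb{N}}$ of its elements. A marked group is $G=\mathbb{F}_\omega/N$ with $N\trianglelefteq\mathbb{F}_\omega$; with $f_N:\mathbb{F}_\omega\to G$ the projection, $G$ is given the enumeration $g_i:=f_N(\gamma_i)$, $i\in\mathbb{N}$ (repetitions allowed). $\mathscr{G}$ denotes the set of all marked groups. A subgroup $H\le G$ is regarded as the marked group $\mathbb{F}_\omega/\ker(f_N\circ\pi_H)$, where $\pi_H:\mathbb{F}_\omega\to\mathbb{F}_\omega$ is the homomorphism with $\pi_H(a_j)=\gamma_j$ if $f_N(\gamma_j)\in H$ and $\pi_H(a_j)=e$ otherwise; but if $H$ is given with a distinguished finite generating set $\{g_{i_0},\dots,g_{i_n}\}$, one instead puts $\pi_H(a_{i_j})=\gamma_{i_j}$ for $0\le j\le n$ and $\pi_H(a_i)=e$ for all other $i$. Trees. A tree is a set $T\subseteq\mathbb{N}^{<\mathbb{N}}$ of finite sequences of natural numbers closed under initial segments; it is well-founded if there is no $x\in\mathbb{N}^{\mathbb{N}}$ all of whose finite initial segments lie in $T$. $|s|$ is the length of $s$ and $(s,n)$ is the sequence $s$ extended by the term $n$. Decomposition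 trees. For a marked group $G$ and $n\ge0$ let $R_n(G):=\langle g_0,\dots,g_n\rangle$ (marked using this generating set), and for $k\ge1$ let $S_k(G):=[G,G]\cap\bigcap\{M\trianglelefteq G\mid |G:M|\le k+1\}$. For $l\ge1$ the tree $T^l(G)$ and marked groups $G_s$ for $s\in T^l(G)$ are defined recursively: $\emptyset\in T^l(G)$ and $G_\emptyset:=G$; if $s\in T^l(G)$ and $G_s\ne\{e\}$, then for every $n\in\mathbb{N}$ put $(s,n)\in T^l(G)$ and $G_{(s,n)}:=S_{|s|+l}(R_n(G_s))$; if $G_s=\{e\}$, then $s$ has no extensions in $T^l(G)$. The class of elementary amenable groups is the smallest class of countable groups that contains all finite groups and all (countable) abelian groups and is closed under group extensions, countable increasing unions, taking subgroups, and taking quotients. *)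

theory Defs
  imports "HOL-Algebra.Algebra"
begin

section \<open>The free group on countably many letters\<close>

text \<open>The letter \<open>(True, i)\<close> is the generator \<open>a\<^sub>i\<close> and \<open>(False, i)\<close> is its inverse. Elements of
  the free group are the reduced words; the product of two reduced words is the reduced form of
  their concatenation.\<close>

type_synonym word = "(bool \<times> nat) list"

definition inv_letter :: "bool \<times> nat \<Rightarrow> bool \<times> nat" where
  "inv_letter x = (\<not> fst x, snd x)"

definition reduced :: "word \<Rightarrow> bool" where
  "reduced w \<longleftrightarrow> successively (\<lambda>x y. y \<noteq> inv_letter x) w"

fun cancel_cons :: "bool \<times> nat \<Rightarrow> word \<Rightarrow> word" where
  "cancel_cons x [] = [x]"
| "cancel_cons x (y # ys) = (if y = inv_letter x then ys else x # y # ys)"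

definition free_grp :: "word monoid" where
  "free_grp = \<lparr>carrier = {w. reduced w}, monoid.mult = foldr cancel_cons, one = []\<rparr>"

definition free_gen :: "nat \<Rightarrow> word" where
  "free_gen i = [(True, i)]"

definition free_lift :: "(nat \<Rightarrow> word) \<Rightarrow> word \<Rightarrow> word" where
  "free_lift \<phi> w = foldr (\<lambda>(b, i) u. (if b then \<phi> i else inv\<^bsub>free_grp\<^esub> (\<phi> i)) \<otimes>\<^bsub>free_grp\<^esub> u) w \<one>\<^bsub>free_grp\<^esub>"

lemma inv_letter_inv_letter [simp]: "inv_letter (inv_letter x) = x"
  by (simp add: inv_letter_def)

lemma inv_letter_neq [simp]: "inv_letter x \<noteq> x" "x \<noteq> inv_letter x"
  by (auto simp: inv_letter_def prod_eq_iff)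

lemma inv_letter_eq_iff: "inv_letter x = y \<longleftrightarrow> x = inv_letter y"
  by (auto simp: inv_letter_def prod_eq_iff)

lemma reduced_Nil [simp]: "reduced []"
  by (simp add: reduced_def)

lemma reduced_Cons: "reduced (x # w) \<longleftrightarrow> w = [] \<or> hd w \<noteq> inv_letter x \<and> reduced w"
  by (auto simp: reduced_def successively_Cons)

lemma reduced_cancel_cons: "reduced w \<Longrightarrow> reduced (cancel_cons x w)"
  by (cases w) (auto simp: reduced_Cons)

lemma cancel_cons_inverse: "reduced w \<Longrightarrow> cancel_cons x (cancel_cons (inv_letter x) w) = w"
  by (cases w rule: remdups_adj.cases) (auto simp: reduced_Cons inv_letter_eq_iff)

lemma cancel_cons_reduced: "reduced (x # w) \<Longrightarrow> cancel_cons x w = x # w"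
  by (cases w) (auto simp: reduced_Cons)

lemma reduced_foldr: "reduced w \<Longrightarrow> reduced (foldr cancel_cons u w)"
  by (induction u) (auto simp: reduced_cancel_cons)

lemma foldr_cancel_cons:
  assumes "reduced w"
  shows "foldr cancel_cons (cancel_cons x u) w = cancel_cons x (foldr cancel_cons u w)"
proof (cases u)
  case (Cons y u')
  show ?thesis
  proof (cases "y = inv_letter x")
    case True
    then show ?thesis
      using cancel_cons_inverse[OF reduced_foldr[OF assms, of u'], of x] Cons by simp
  qed (simp add: Cons)
qed simp

lemma foldr_cancel_assoc:
  assumes "reduced w"
  shows "foldr cancel_cons (foldr cancel_cons u v) w = foldr cancel_cons u (foldr cancel_cons v w)"
  by (induction u) (auto simp: foldr_cancel_cons[OF assms])

lemma foldr_cancel_Nil: "reduced w \<Longrightarrow> foldr cancel_cons w [] = w"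
proof (induction w)
  case (Cons x w)
  moreover have "reduced w" using Cons.prems by (auto simp: reduced_Cons)
  ultimately show ?case by (simp add: cancel_cons_reduced)
qed simp

lemma reduced_formal_inverse: "reduced w \<Longrightarrow> reduced (rev (map inv_letter w))"
  unfolding reduced_def
  by (simp add: successively_map, erule successively_mono, auto simp: inv_letter_eq_iff)

lemma foldr_formal_inverse:
  "reduced v \<Longrightarrow> foldr cancel_cons (rev (map inv_letter w)) (foldr cancel_cons w v) = v"
proof (induction w arbitrary: v)
  case (Cons x w)
  have "cancel_cons (inv_letter x) (cancel_cons x (foldr cancel_cons w v)) = foldr cancel_cons w v"
    using cancel_cons_inverse[OF reduced_foldr[OF Cons.prems, of w], of "inv_letter x"] by simp
  then show ?case using Cons by simp
qed simp

lemma group_free_grp: "group free_grp"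
proof (rule groupI)
  fix x assume x: "x \<in> carrier free_grp"
  have "foldr cancel_cons (rev (map inv_letter x)) (foldr cancel_cons x []) = []"
    by (rule foldr_formal_inverse) simp
  then show "\<exists>y\<in>carrier free_grp. y \<otimes>\<^bsub>free_grp\<^esub> x = \<one>\<^bsub>free_grp\<^esub>"
    using x by (intro bexI[of _ "rev (map inv_letter x)"])
      (auto simp: free_grp_def foldr_cancel_Nil intro: reduced_formal_inverse)
qed (auto simp: free_grp_def reduced_foldr foldr_cancel_assoc)

lemma free_gen_closed: "free_gen i \<in> carrier free_grp"
  by (simp add: free_gen_def free_grp_def reduced_Cons)

lemma free_lift_hom:
  assumes \<phi>: "\<And>i. \<phi> i \<in> carrier free_grp"
  shows "free_lift \<phi> \<in> hom free_grp free_grp"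
proof -
  interpret group free_grp by (rule group_free_grp)
  define L where "L = (\<lambda>x. if fst x then \<phi> (snd x) else inv\<^bsub>free_grp\<^esub> (\<phi> (snd x)))"
  have L: "L x \<in> carrier free_grp" for x using \<phi> by (simp add: L_def)
  have Linv: "L x \<otimes>\<^bsub>free_grp\<^esub> L (inv_letter x) = \<one>\<^bsub>free_grp\<^esub>" for x
    using \<phi> by (simp add: L_def inv_letter_def)
  have Cons: "free_lift \<phi> (x # w) = L x \<otimes>\<^bsub>free_grp\<^esub> free_lift \<phi> w" for x w
    by (simp add: free_lift_def L_def case_prod_beta)
  have Nil: "free_lift \<phi> [] = \<one>\<^bsub>free_grp\<^esub>" by (simp add: free_lift_def)
  have cl: "free_lift \<phi> w \<in> carrier free_grp" for w
    by (induction w) (auto simp: Cons Nil L)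
  have cc: "free_lift \<phi> (cancel_cons x w) = L x \<otimes>\<^bsub>free_grp\<^esub> free_lift \<phi> w" for x w
  proof (cases w)
    case w: (Cons y ys)
    show ?thesis
    proof (cases "y = inv_letter x")
      case True
      then show ?thesis using w by (simp add: Cons m_assoc[symmetric] L cl Linv)
    qed (simp add: w Cons)
  qed (simp add: Cons)
  have "free_lift \<phi> (foldr cancel_cons u v) = free_lift \<phi> u \<otimes>\<^bsub>free_grp\<^esub> free_lift \<phi> v" for u v
    by (induction u) (auto simp: cc Cons Nil cl L m_assoc)
  moreover have "monoid.mult free_grp = foldr cancel_cons" by (simp add: free_grp_def)
  ultimately show ?thesis using cl by (auto simp: hom_def)
qed

lemma free_lift_gen:
  assumes "\<phi> i \<in> carrier free_grp"
  shows "free_lift \<phi> (free_gen i) = \<phi> i"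
proof -
  interpret group free_grp by (rule group_free_grp)
  show ?thesis using assms by (simp add: free_lift_def free_gen_def)
qed

section \<open>Marked groups\<close>

text \<open>A marked group \<open>free_grp Mod N\<close> is represented by the normal subgroup \<open>N\<close> of \<open>free_grp\<close>.
  Throughout, \<open>\<gamma>\<close> is the fixed enumeration of \<open>free_grp\<close>.\<close>

definition mproj :: "word set \<Rightarrow> word \<Rightarrow> word set" where
  "mproj N w = N #>\<^bsub>free_grp\<^esub> w"

definition menum :: "(nat \<Rightarrow> word) \<Rightarrow> word set \<Rightarrow> nat \<Rightarrow> word set" where
  "menum \<gamma> N i = mproj N (\<gamma> i)"

definition mark_along :: "word set \<Rightarrow> (nat \<Rightarrow> word) \<Rightarrow> word set" where
  "mark_along N \<phi> = kernel free_grp (free_grp Mod N) (mproj N \<circ> free_lift \<phi>)"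

text \<open>\<open>mark_subgroup\<close> is the marking of a bare subgroup \<open>H\<close> of \<open>free_grp Mod N\<close>; \<open>mark_generated\<close>
  is that of the subgroup given with the distinguished generators \<open>g\<^sub>i\<close>, \<open>i \<in> I\<close>.\<close>

definition mark_subgroup :: "(nat \<Rightarrow> word) \<Rightarrow> word set \<Rightarrow> word set set \<Rightarrow> word set" where
  "mark_subgroup \<gamma> N H =
     mark_along N (\<lambda>j. if menum \<gamma> N j \<in> H then \<gamma> j else \<one>\<^bsub>free_grp\<^esub>)"

definition mark_generated :: "(nat \<Rightarrow> word) \<Rightarrow> word set \<Rightarrow> nat set \<Rightarrow> word set" where
  "mark_generated \<gamma> N I =
     mark_along N (\<lambda>j. if j \<in> I then \<gamma> j else \<one>\<^bsub>free_grp\<^esub>)"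

text \<open>The markings present the intended subgroups of \<open>free_grp Mod N\<close>.\<close>

lemma mproj_hom: assumes "N \<lhd> free_grp"
  shows "group_hom free_grp (free_grp Mod N) (mproj N)"
proof -
  interpret normal N free_grp by fact
  show ?thesis
    unfolding mproj_def
    by (intro group_hom.intro group_hom_axioms.intro group_axioms factorgroup_is_group r_coset_hom_Mod)
qed

lemma mark_along_hom:
  assumes "N \<lhd> free_grp" "\<And>i. \<phi> i \<in> carrier free_grp"
  shows "group_hom free_grp (free_grp Mod N) (mproj N \<circ> free_lift \<phi>)"
  using mproj_hom[OF assms(1)] free_lift_hom[of \<phi>] assms(2) hom_compose
  unfolding group_hom_def group_hom_axioms_def by blast

lemma mark_along_normal:
  assumes "N \<lhd> free_grp" "\<And>i. \<phi> i \<in> carrier free_grp"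
  shows "mark_along N \<phi> \<lhd> free_grp"
  unfolding mark_along_def using group_hom.normal_kernel[OF mark_along_hom[OF assms]] .

lemma free_grp_generated: "generate free_grp (range free_gen) = carrier free_grp"
proof
  interpret group free_grp by (rule group_free_grp)
  show "generate free_grp (range free_gen) \<subseteq> carrier free_grp"
    by (rule generate_incl) (auto simp: free_gen_closed)
  have l: "[x] \<in> generate free_grp (range free_gen)" for x
  proof (cases x)
    case (Pair b i)
    have "inv\<^bsub>free_grp\<^esub> (free_gen i) = [(False, i)]"
      by (rule inv_equality) (auto simp: free_gen_def free_grp_def reduced_Cons inv_letter_def)
    then show ?thesis
      using Pair generate.incl[of "free_gen i" "range free_gen" free_grp]
        generate.inv[of "free_gen i" "range free_gen" free_grp]
      by (cases b) (auto simp: free_gen_def)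
  qed
  have "reduced w \<Longrightarrow> w \<in> generate free_grp (range free_gen)" for w
  proof (induction w)
    case Nil
    then show ?case using generate.one[of free_grp "range free_gen"] by (simp add: free_grp_def)
  next
    case (Cons x w)
    have "reduced w" using Cons.prems by (auto simp: reduced_Cons)
    moreover have "x # w = [x] \<otimes>\<^bsub>free_grp\<^esub> w"
      using cancel_cons_reduced[OF Cons.prems] by (simp add: free_grp_def)
    ultimately show ?case using generate.eng[OF l[of x] Cons.IH] by simp
  qed
  then show "carrier free_grp \<subseteq> generate free_grp (range free_gen)"
    by (auto simp: free_grp_def)
qed

lemma mark_along_iso:
  assumes "N \<lhd> free_grp" "\<And>i. \<phi> i \<in> carrier free_grp"
  shows "free_grp Mod mark_along N \<phi> \<cong>
    (free_grp Mod N)\<lparr>carrier := generate (free_grp Mod N) (range (\<lambda>i. mproj N (\<phi> i)))\<rparr>"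
proof -
  let ?h = "mproj N \<circ> free_lift \<phi>"
  let ?H = "generate (free_grp Mod N) (range (\<lambda>i. mproj N (\<phi> i)))"
  let ?G = "(free_grp Mod N)\<lparr>carrier := ?H\<rparr>"
  interpret h: group_hom free_grp "free_grp Mod N" ?h by (rule mark_along_hom[OF assms])
  have "range free_gen \<subseteq> carrier free_grp" using free_gen_closed by blast
  from h.generate_img[OF this] have img: "?h ` carrier free_grp = ?H"
    by (simp add: free_grp_generated image_image free_lift_gen assms(2))
  have "subgroup ?H (free_grp Mod N)" using h.img_is_subgroup unfolding img .
  then have G: "group ?G" by (rule h.H.subgroup_imp_group)
  have "?h x \<in> ?H" if "x \<in> carrier free_grp" for x
    unfolding img[symmetric] using that by (rule imageI)
  then have "?h \<in> hom free_grp ?G"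
    using h.hom_mult by (simp add: hom_def Pi_def)
  then have "group_hom free_grp ?G ?h"
    using G h.G.group_axioms by (intro group_hom.intro group_hom_axioms.intro)
  then interpret k: group_hom free_grp ?G ?h .
  have "free_grp Mod kernel free_grp ?G ?h \<cong> ?G"
    by (rule k.FactGroup_iso) (simp add: img[unfolded o_def])
  then show ?thesis by (simp add: mark_along_def kernel_def)
qed

lemma mark_subgroup_iso:
  assumes "N \<lhd> free_grp" "range \<gamma> = carrier free_grp" "subgroup H (free_grp Mod N)"
  shows "free_grp Mod mark_subgroup \<gamma> N H \<cong> (free_grp Mod N)\<lparr>carrier := H\<rparr>"
proof -
  interpret p: group_hom free_grp "free_grp Mod N" "mproj N" by (rule mproj_hom[OF assms(1)])
  interpret H: subgroup H "free_grp Mod N" by (rule assms(3))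
  let ?\<phi> = "\<lambda>j. if menum \<gamma> N j \<in> H then \<gamma> j else \<one>\<^bsub>free_grp\<^esub>"
  have g: "\<gamma> j \<in> carrier free_grp" for j using assms(2) by blast
  have \<phi>: "?\<phi> j \<in> carrier free_grp" for j using g by simp
  have "range (\<lambda>i. mproj N (?\<phi> i)) = H"
  proof
    show "range (\<lambda>i. mproj N (?\<phi> i)) \<subseteq> H"
      using p.hom_one H.one_closed by (auto simp: menum_def)
    show "H \<subseteq> range (\<lambda>i. mproj N (?\<phi> i))"
    proof
      fix x assume x: "x \<in> H"
      then have "x \<in> carrier (free_grp Mod N)" using H.subset by blast
      then obtain w where w: "w \<in> carrier free_grp" "x = mproj N w"
        by (auto simp: FactGroup_def RCOSETS_def mproj_def)
      then obtain j where "w = \<gamma> j" using assms(2) by blast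
      with w x show "x \<in> range (\<lambda>i. mproj N (?\<phi> i))"
        by (intro image_eqI[of _ _ j]) (auto simp: menum_def)
    qed
  qed
  moreover have "generate (free_grp Mod N) H = H"
    using p.H.generateI[OF assms(3)] by blast
  ultimately show ?thesis
    using mark_along_iso[where \<phi> = ?\<phi>, OF assms(1) \<phi>] by (simp add: mark_subgroup_def)
qed

section \<open>Decomposition trees\<close>

text \<open>\<open>card\<close> is \<open>0\<close> on infinite sets, so finiteness of the index is required explicitly.\<close>

definition S_subgroup :: "nat \<Rightarrow> ('a, 'b) monoid_scheme \<Rightarrow> 'a set" where
  "S_subgroup k G = derived G (carrier G) \<inter>
     \<Inter>{M. M \<lhd> G \<and> finite (rcosets\<^bsub>G\<^esub> M) \<and> card (rcosets\<^bsub>G\<^esub> M) \<le> k + 1}"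

definition marked_R :: "(nat \<Rightarrow> word) \<Rightarrow> nat \<Rightarrow> word set \<Rightarrow> word set" where
  "marked_R \<gamma> n N = mark_generated \<gamma> N {0..n}"

definition marked_S :: "(nat \<Rightarrow> word) \<Rightarrow> nat \<Rightarrow> word set \<Rightarrow> word set" where
  "marked_S \<gamma> k N = mark_subgroup \<gamma> N (S_subgroup k (free_grp Mod N))"

text \<open>Sequences grow at the end, whence the reversal. \<open>decomp_group\<close> is total; it is only of
  interest on the tree.\<close>

primrec decomp_group_rev :: "(nat \<Rightarrow> word) \<Rightarrow> nat \<Rightarrow> word set \<Rightarrow> nat list \<Rightarrow> word set" where
  "decomp_group_rev \<gamma> l N [] = N"
| "decomp_group_rev \<gamma> l N (n # s) =
     marked_S \<gamma> (length s + l) (marked_R \<gamma> n (decomp_group_rev \<gamma> l N s))"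

definition decomp_group :: "(nat \<Rightarrow> word) \<Rightarrow> nat \<Rightarrow> word set \<Rightarrow> nat list \<Rightarrow> word set" where
  "decomp_group \<gamma> l N s = decomp_group_rev \<gamma> l N (rev s)"

inductive_set decomp_tree :: "(nat \<Rightarrow> word) \<Rightarrow> nat \<Rightarrow> word set \<Rightarrow> nat list set"
  for \<gamma> :: "nat \<Rightarrow> word" and l :: nat and N :: "word set" where
  root: "[] \<in> decomp_tree \<gamma> l N"
| extend: "\<lbrakk>s \<in> decomp_tree \<gamma> l N;
     carrier (free_grp Mod decomp_group \<gamma> l N s) \<noteq> {\<one>\<^bsub>free_grp Mod decomp_group \<gamma> l N s\<^esub>}\<rbrakk>
     \<Longrightarrow> s @ [n] \<in> decomp_tree \<gamma> l N"

definition well_founded_tree :: "nat list set \<Rightarrow> bool" where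
  "well_founded_tree T \<longleftrightarrow> \<not> (\<exists>x :: nat \<Rightarrow> nat. \<forall>m. map x [0..<m] \<in> T)"

lemma decomp_group_Nil: "decomp_group \<gamma> l N [] = N"
  by (simp add: decomp_group_def)

lemma decomp_group_snoc:
  "decomp_group \<gamma> l N (s @ [n]) = marked_S \<gamma> (length s + l) (marked_R \<gamma> n (decomp_group \<gamma> l N s))"
  by (simp add: decomp_group_def)

text \<open>In particular, \<open>marked_R\<close> presents the subgroup generated by the first \<open>n + 1\<close> elements.\<close>

lemma marked_R_iso:
  assumes "N \<lhd> free_grp" "range \<gamma> = carrier free_grp"
  shows "free_grp Mod marked_R \<gamma> n N \<cong>
    (free_grp Mod N)\<lparr>carrier := generate (free_grp Mod N) (menum \<gamma> N ` {0..n})\<rparr>"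
proof -
  interpret p: group_hom free_grp "free_grp Mod N" "mproj N" by (rule mproj_hom[OF assms(1)])
  let ?\<phi> = "\<lambda>j. if j \<in> {0..n} then \<gamma> j else \<one>\<^bsub>free_grp\<^esub>"
  have g: "\<gamma> j \<in> carrier free_grp" for j using assms(2) by blast
  have \<phi>: "?\<phi> j \<in> carrier free_grp" for j using g by simp
  have aux: "range (\<lambda>i. f (if i \<in> {0..n} then \<gamma> i else z)) = insert (f z) ((\<lambda>i. f (\<gamma> i)) ` {0..n})"
    for f :: "word \<Rightarrow> word set" and z
  proof -
    have "f z \<in> range (\<lambda>i. f (if i \<in> {0..n} then \<gamma> i else z))"
      by (rule image_eqI[of _ _ "Suc n"]) simp_all
    moreover have "(\<lambda>i. f (\<gamma> i)) ` {0..n} \<subseteq> range (\<lambda>i. f (if i \<in> {0..n} then \<gamma> i else z))"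
      by (rule image_subsetI, rule_tac x = x in image_eqI) simp_all
    moreover have "range (\<lambda>i. f (if i \<in> {0..n} then \<gamma> i else z)) \<subseteq> insert (f z) ((\<lambda>i. f (\<gamma> i)) ` {0..n})"
    proof (rule image_subsetI)
      fix i
      show "f (if i \<in> {0..n} then \<gamma> i else z) \<in> insert (f z) ((\<lambda>i. f (\<gamma> i)) ` {0..n})"
        by (cases "i \<in> {0..n}") simp_all
    qed
    ultimately show ?thesis by (intro equalityI) (simp_all only: insert_subset simp_thms)
  qed
  have r: "range (\<lambda>i. mproj N (?\<phi> i)) = insert \<one>\<^bsub>free_grp Mod N\<^esub> (menum \<gamma> N ` {0..n})"
    unfolding aux p.hom_one menum_def by (rule refl)
  have c: "menum \<gamma> N ` {0..n} \<subseteq> carrier (free_grp Mod N)"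
    using g p.hom_closed by (auto simp: menum_def)
  let ?X = "menum \<gamma> N ` {0..n}"
  have "insert \<one>\<^bsub>free_grp Mod N\<^esub> ?X \<subseteq> generate (free_grp Mod N) ?X"
    using generate.one[of "free_grp Mod N" ?X] generate.incl[of _ ?X "free_grp Mod N"] by blast
  then have "generate (free_grp Mod N) (insert \<one>\<^bsub>free_grp Mod N\<^esub> ?X) \<subseteq> generate (free_grp Mod N) ?X"
    by (rule p.H.generate_subgroup_incl[OF _ p.H.generate_is_subgroup[OF c]])
  moreover have "generate (free_grp Mod N) ?X \<subseteq> generate (free_grp Mod N) (insert \<one>\<^bsub>free_grp Mod N\<^esub> ?X)"
    by (rule p.H.mono_generate) blast
  ultimately have "generate (free_grp Mod N) (insert \<one>\<^bsub>free_grp Mod N\<^esub> ?X) = generate (free_grp Mod N) ?X"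
    by (rule equalityI)
  then show ?thesis
    using mark_along_iso[where \<phi> = ?\<phi>, OF assms(1) \<phi>]
    unfolding r marked_R_def mark_generated_def by (simp only:)
qed

lemma S_subgroup_subgroup:
  assumes "group G"
  shows "subgroup (S_subgroup k G) G"
proof -
  interpret group G by fact
  let ?A = "insert (derived G (carrier G)) {M. M \<lhd> G \<and> finite (rcosets\<^bsub>G\<^esub> M) \<and> card (rcosets\<^bsub>G\<^esub> M) \<le> k + 1}"
  have "subgroup (\<Inter>?A) G"
  proof (rule subgroups_Inter)
    fix M assume "M \<in> ?A"
    then consider "M = derived G (carrier G)" | "M \<lhd> G" by blast
    then show "subgroup M G"
    proof cases
      case 1
      then show ?thesis using derived_is_subgroup[of "carrier G"] by simp
    next
      case 2
      then show ?thesis by (rule normal_imp_subgroup)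
    qed
  qed blast
  then show ?thesis by (simp add: S_subgroup_def)
qed

lemma decomp_tree_initial_segment: "s @ [n] \<in> decomp_tree \<gamma> l N \<Longrightarrow> s \<in> decomp_tree \<gamma> l N"
  by (erule decomp_tree.cases) auto

section \<open>Elementary amenable groups\<close>

text \<open>Every countable group is isomorphic to one whose carrier consists of natural numbers, so the
  class is generated among those; quotients enter up to isomorphism because their elements are
  cosets. Closure under isomorphism is the case of the quotient by the trivial subgroup.\<close>

inductive EA :: "nat monoid \<Rightarrow> bool" where
  finite: "\<lbrakk>group G; finite (carrier G)\<rbrakk> \<Longrightarrow> EA G"
| abelian: "comm_group G \<Longrightarrow> EA G"
| extension: "\<lbrakk>N \<lhd> G; EA (G\<lparr>carrier := N\<rparr>); EA Q; G Mod N \<cong> Q\<rbrakk> \<Longrightarrow> EA G"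
| increasing_union: "\<lbrakk>group G; \<And>i. subgroup (H i) G; \<And>i. H i \<subseteq> H (Suc i);
     (\<Union>i::nat. H i) = carrier G; \<And>i. EA (G\<lparr>carrier := H i\<rparr>)\<rbrakk> \<Longrightarrow> EA G"
| subgroup: "\<lbrakk>EA G; subgroup H G\<rbrakk> \<Longrightarrow> EA (G\<lparr>carrier := H\<rparr>)"
| quotient: "\<lbrakk>EA G; N \<lhd> G; group Q; G Mod N \<cong> Q\<rbrakk> \<Longrightarrow> EA Q"

definition elementary_amenable :: "('a, 'b) monoid_scheme \<Rightarrow> bool" where
  "elementary_amenable G \<longleftrightarrow> group G \<and> (\<exists>H. EA H \<and> G \<cong> H)"

end

theory Submission
  imports Defs "HOL-Library.Countable_Set"
begin

text \<open>
  Up to isomorphism, the groups along a branch of the decomposition tree form a descending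
  sequence of subgroups of the group at the root. So an infinite branch amounts to a
  \<open>residual_chain\<close>: nontrivial finitely generated subgroups \<open>F 0 \<supseteq> F 1 \<supseteq> \<dots>\<close> with
  \<open>F (i + 1) \<subseteq> S_subgroup (i + l) (F i)\<close>. This notion does not mention markings.

  Elementary amenable groups have no such chains, whatever \<open>l\<close> is. In an abelian group,
  \<open>S_subgroup\<close> is trivial; in a finite group it becomes trivial once the index bound exceeds the
  order. In an extension, a chain is pushed to the quotient, where it must reach the trivial group;
  afterwards it stays in the kernel. In an increasing union, the finitely generated first term, and
  with it the whole chain, lies in one of the members. The delicate case is that of quotients,
  because a chain in a quotient need not lift: \<open>S_subgroup k\<close> of a group may map to a proper
  subgroup of \<open>S_subgroup k\<close> of the quotient. Therefore the induction
  (\<open>EA_sections_chain_free\<close>) shows more, namely that no section (quotient of a subgroup) of the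
  group has a chain. This makes the cases of subgroups and quotients immediate, and sections of
  extensions and unions decompose accordingly.

  Conversely, suppose that the tree is well-founded for one \<open>l\<close>. A finitely generated group has
  only finitely many subgroups of bounded index (\<open>finite_subgroups_bounded_index\<close>), so for
  finitely generated \<open>R\<close> the quotient of \<open>[R, R]\<close> by \<open>S_subgroup k R\<close> is finite, and \<open>R\<close> is elementary
  amenable as soon as \<open>S_subgroup k R\<close> is. If all children of a vertex carry elementary amenable
  groups, then so does the vertex, being the increasing union of such groups \<open>R\<close>. Hence a vertex with
  a group that is not elementary amenable would start an infinite branch.
\<close>

section \<open>Residual subgroups and homomorphisms\<close>

text \<open>Both ingredients of \<open>S_subgroup\<close> are functorial for surjections: commutators map to
  commutators, and a normal subgroup \<open>M\<close> of \<open>H\<close> pulls back to the kernel of \<open>G \<rightarrow> H/M\<close>, which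
  has the same index. The inclusion can be strict, since normal subgroups of \<open>G\<close> need not contain
  the kernel of \<open>h\<close>; chains therefore push forward to quotients but need not lift from them.\<close>

lemma S_subgroup_image:
  assumes "group_hom G H h" "h ` carrier G = carrier H"
  shows "h ` S_subgroup k G \<subseteq> S_subgroup k H"
proof -
  interpret h: group_hom G H h by fact
  have D: "h ` derived G (carrier G) = derived H (carrier H)"
    using h.derived_img[of "carrier G"] assms(2) by simp
  have "h x \<in> M"
    if x: "x \<in> S_subgroup k G" and M: "M \<lhd> H" "finite (rcosets\<^bsub>H\<^esub> M)" "card (rcosets\<^bsub>H\<^esub> M) \<le> k + 1" for x M
  proof -
    interpret M: normal M H by fact
    \<comment> \<open>the pullback of \<open>M\<close> is the kernel of \<open>?f\<close>, with quotient isomorphic to \<open>H Mod M\<close>\<close>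
    let ?f = "(\<lambda>y. M #>\<^bsub>H\<^esub> y) \<circ> h"
    have xc: "x \<in> carrier G"
      using x subgroup.subset[OF S_subgroup_subgroup[OF h.G.group_axioms]] by blast
    have f: "group_hom G (H Mod M) ?f"
      using hom_compose[OF h.homh M.r_coset_hom_Mod] M.factorgroup_is_group h.G.group_axioms
      by (intro group_hom.intro group_hom_axioms.intro)
    have "?f ` carrier G = carrier (H Mod M)"
      by (simp only: image_comp[symmetric] assms(2)) (auto simp: carrier_FactGroup)
    then have iso: "G Mod kernel G (H Mod M) ?f \<cong> H Mod M"
      by (rule group_hom.FactGroup_iso[OF f])
    have "kernel G (H Mod M) ?f \<lhd> G" by (rule group_hom.normal_kernel[OF f])
    then have "x \<in> kernel G (H Mod M) ?f"
      using x M(2,3) iso_finite[OF iso] iso_same_card[OF iso]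
      unfolding S_subgroup_def FactGroup_def by simp
    then have "M #>\<^bsub>H\<^esub> h x = M" by (simp add: kernel_def)
    then show "h x \<in> M" using h.H.coset_join1 M.subgroup_axioms xc by simp
  qed
  moreover have "h x \<in> derived H (carrier H)" if "x \<in> S_subgroup k G" for x
    using that D by (auto simp: S_subgroup_def)
  ultimately show ?thesis unfolding S_subgroup_def[of k H] by blast
qed

lemma S_subgroup_iso_image:
  assumes "group G" "group H" "h \<in> iso G H"
  shows "h ` S_subgroup k G = S_subgroup k H"
proof
  have h: "h \<in> hom G H" "h ` carrier G = carrier H" "inj_on h (carrier G)"
    using assms(3) by (auto simp: iso_iff)
  show "h ` S_subgroup k G \<subseteq> S_subgroup k H"
    using assms h by (intro S_subgroup_image group_hom.intro group_hom_axioms.intro)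
  let ?g = "inv_into (carrier G) h"
  have g: "?g \<in> iso H G" by (rule group.iso_set_sym[OF assms(1,3)])
  then have "?g ` S_subgroup k H \<subseteq> S_subgroup k G"
    using assms by (intro S_subgroup_image group_hom.intro group_hom_axioms.intro) (auto simp: iso_iff)
  moreover have "S_subgroup k H \<subseteq> carrier H"
    by (rule subgroup.subset[OF S_subgroup_subgroup[OF assms(2)]])
  ultimately show "S_subgroup k H \<subseteq> h ` S_subgroup k G"
  proof (intro subsetI image_eqI)
    fix y assume "y \<in> S_subgroup k H" and sub: "S_subgroup k H \<subseteq> carrier H"
      "?g ` S_subgroup k H \<subseteq> S_subgroup k G"
    then show "?g y \<in> S_subgroup k G" by blast
    have "y \<in> h ` carrier G" using sub \<open>y \<in> _\<close> h(2) by blast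
    then show "y = h (?g y)" by (simp add: f_inv_into_f)
  qed
qed

lemma S_subgroup_comm:
  fixes G (structure)
  assumes "comm_group G"
  shows "S_subgroup k G = {\<one>\<^bsub>G\<^esub>}"
proof -
  interpret comm_group G by fact
  show ?thesis
    using derived_eq_singleton[of "carrier G"] subgroup.one_closed[OF S_subgroup_subgroup[OF is_group, of k]]
    unfolding S_subgroup_def by auto
qed

lemma S_subgroup_small:
  fixes G (structure)
  assumes "group G" "finite (carrier G)" "card (carrier G) \<le> k + 1"
  shows "S_subgroup k G = {\<one>\<^bsub>G\<^esub>}"
proof -
  interpret group G by fact
  have r: "rcosets {\<one>} = (\<lambda>x. {\<one>} #> x) ` carrier G" by (auto simp: RCOSETS_def)
  have "card (rcosets {\<one>}) \<le> k + 1"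
    unfolding r using card_image_le[OF assms(2)] assms(3) le_trans by blast
  moreover have "finite (rcosets {\<one>})" unfolding r using assms(2) by simp
  ultimately show ?thesis
    using one_is_normal subgroup.one_closed[OF S_subgroup_subgroup[OF is_group, of k]]
    unfolding S_subgroup_def by auto
qed

section \<open>Chains of finitely generated subgroups\<close>

definition finitely_generated :: "('a, 'b) monoid_scheme \<Rightarrow> 'a set \<Rightarrow> bool" where
  "finitely_generated G H \<longleftrightarrow> (\<exists>A. finite A \<and> A \<subseteq> carrier G \<and> H = generate G A)"

text \<open>What remains of an infinite branch of a decomposition tree once all its groups are viewed
  inside the group at the root: \<open>F i\<close> is a finitely generated subgroup of the \<open>i\<close>-th vertex group.
  Only an inclusion of the next term in the residual subgroup is required, so that chains survive
  homomorphisms.\<close>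

definition residual_chain :: "nat \<Rightarrow> ('a, 'b) monoid_scheme \<Rightarrow> (nat \<Rightarrow> 'a set) \<Rightarrow> bool" where
  "residual_chain l G F \<longleftrightarrow> (\<forall>i. finitely_generated G (F i) \<and> F i \<noteq> {\<one>\<^bsub>G\<^esub>} \<and>
     F (Suc i) \<subseteq> S_subgroup (i + l) (G\<lparr>carrier := F i\<rparr>))"

lemma finitely_generated_subgroup:
  "group G \<Longrightarrow> finitely_generated G H \<Longrightarrow> subgroup H G"
  by (auto simp: finitely_generated_def intro: group.generate_is_subgroup)

lemma finitely_generated_image:
  assumes "group_hom G H h" "finitely_generated G K"
  shows "finitely_generated H (h ` K)"
proof -
  interpret group_hom G H h by fact
  obtain A where "finite A" "A \<subseteq> carrier G" "K = generate G A"
    using assms(2) by (auto simp: finitely_generated_def)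
  then show ?thesis
    unfolding finitely_generated_def using generate_img[of A]
    by (intro exI[of _ "h ` A"]) auto
qed

lemma finitely_generated_restrict:
  assumes "group G" "subgroup K G" "finitely_generated G H" "H \<subseteq> K"
  shows "finitely_generated (G\<lparr>carrier := K\<rparr>) H"
proof -
  obtain A where A: "finite A" "A \<subseteq> carrier G" "H = generate G A"
    using assms(3) by (auto simp: finitely_generated_def)
  have "A \<subseteq> K" using assms(4) A(3) generate.incl[of _ A G] by blast
  then show ?thesis
    using A group.generate_consistent[OF assms(1) _ assms(2), of A] by (auto simp: finitely_generated_def)
qed

text \<open>The offset absorbs the removed terms. Because \<open>l\<close> is quantified away below, the property of
  having no chain is insensitive to dropping initial terms.\<close>

lemma residual_chain_tail:
  "residual_chain l G F \<Longrightarrow> residual_chain (j + l) G (\<lambda>i. F (i + j))"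
  unfolding residual_chain_def
proof
  fix i
  assume "\<forall>i. finitely_generated G (F i) \<and> F i \<noteq> {\<one>\<^bsub>G\<^esub>} \<and>
    F (Suc i) \<subseteq> S_subgroup (i + l) (G\<lparr>carrier := F i\<rparr>)"
  from spec[OF this, of "i + j"]
  show "finitely_generated G (F (i + j)) \<and> F (i + j) \<noteq> {\<one>\<^bsub>G\<^esub>} \<and>
    F (Suc i + j) \<subseteq> S_subgroup (i + (j + l)) (G\<lparr>carrier := F (i + j)\<rparr>)"
    by (simp add: add.assoc)
qed

lemma residual_chain_antimono:
  assumes "group G" "residual_chain l G F" 
  shows "F i \<subseteq> F 0"
proof (induction i)
  case (Suc i)
  have "group (G\<lparr>carrier := F i\<rparr>)"
    using assms finitely_generated_subgroup[OF assms(1), of "F i"]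
    by (auto simp: residual_chain_def intro: group.subgroup_imp_group)
  from subgroup.subset[OF S_subgroup_subgroup[OF this]]
  have "F (Suc i) \<subseteq> F i" using assms(2) by (fastforce simp: residual_chain_def)
  with Suc show ?case by blast
qed simp

lemma residual_chain_image:
  assumes "group_hom G H h" "residual_chain l G F" "\<And>i. h ` F i \<noteq> {\<one>\<^bsub>H\<^esub>}"
  shows "residual_chain l H (\<lambda>i. h ` F i)"
  unfolding residual_chain_def
proof (intro allI conjI)
  fix i
  interpret group_hom G H h by fact
  have F: "finitely_generated G (F i)" "F (Suc i) \<subseteq> S_subgroup (i + l) (G\<lparr>carrier := F i\<rparr>)"
    using assms(2) by (auto simp: residual_chain_def)
  show "finitely_generated H (h ` F i)" by (rule finitely_generated_image[OF assms(1) F(1)])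
  show "h ` F i \<noteq> {\<one>\<^bsub>H\<^esub>}" by (rule assms(3))
  have "group_hom (G\<lparr>carrier := F i\<rparr>) (H\<lparr>carrier := h ` F i\<rparr>) h"
    by (rule induced_group_hom[OF finitely_generated_subgroup[OF G.is_group F(1)]])
  from S_subgroup_image[OF this] F(2)
  show "h ` F (Suc i) \<subseteq> S_subgroup (i + l) (H\<lparr>carrier := h ` F i\<rparr>)" by fastforce
qed

lemma residual_chain_restrict:
  fixes G (structure)
  assumes "group G" "residual_chain l G F" "subgroup K G" "F 0 \<subseteq> K"
  shows "residual_chain l (G\<lparr>carrier := K\<rparr>) F"
  unfolding residual_chain_def
proof (intro allI conjI)
  fix i
  interpret group G by fact
  have F: "finitely_generated G (F i)" "F i \<noteq> {\<one>}" "F (Suc i) \<subseteq> S_subgroup (i + l) (G\<lparr>carrier := F i\<rparr>)"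
    using assms(2) by (auto simp: residual_chain_def)
  have "F i \<subseteq> K" using residual_chain_antimono[OF assms(1,2)] assms(4) by blast
  then show "finitely_generated (G\<lparr>carrier := K\<rparr>) (F i)"
    by (rule finitely_generated_restrict[OF assms(1,3) F(1)])
  show "F i \<noteq> {\<one>\<^bsub>G\<lparr>carrier := K\<rparr>\<^esub>}" using F(2) by simp
  show "F (Suc i) \<subseteq> S_subgroup (i + l) (G\<lparr>carrier := K, carrier := F i\<rparr>)" using F(3) by simp
qed

section \<open>Absence of residual chains in elementary amenable groups\<close>

lemma finitely_generated_subset_directed_union:
  fixes K :: "nat \<Rightarrow> 'a set"
  assumes "group G" "finitely_generated G H" "H \<subseteq> (\<Union>i. K i)"
    and "\<And>i. subgroup (K i) G" "\<And>i. K i \<subseteq> K (Suc i)"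
  obtains m where "H \<subseteq> K m"
proof -
  obtain A where A: "finite A" "H = generate G A" "A \<subseteq> carrier G"
    using assms(2) by (auto simp: finitely_generated_def)
  have "A \<subseteq> (\<Union>i. K i)" using A(2) assms(3) generate.incl[of _ A G] by blast
  with A(1) obtain I where I: "finite I" "A \<subseteq> (\<Union>i\<in>I. K i)"
    using finite_subset_Union[of A "range K"] by (metis finite_subset_image)
  have mono: "mono K" using assms(5) by (intro incseq_SucI)
  have "A \<subseteq> K (Max (insert 0 I))"
  proof
    fix a assume "a \<in> A"
    then obtain i where "i \<in> I" "a \<in> K i" using I by blast
    then show "a \<in> K (Max (insert 0 I))" using monoD[OF mono, of i "Max (insert 0 I)"] I(1) by auto
  qed
  then show thesis
    using that group.generate_subgroup_incl[OF assms(1)] assms(4) A(2) by blast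
qed

text \<open>Once the index bound exceeds the order of the group, the trivial subgroup is among the
  subgroups being intersected.\<close>

lemma no_residual_chain_finite:
  assumes "group G" "finite (carrier G)"
  shows "\<not> residual_chain l G F"
proof
  assume ch: "residual_chain l G F"
  \<comment> \<open>the bound at step \<open>i\<close> is \<open>i + l + 1\<close>, which covers the order of \<open>G\<close> from \<open>i = card (carrier G)\<close> on\<close>
  let ?n = "card (carrier G)"
  have sub: "subgroup (F i) G" for i
    using ch assms(1) finitely_generated_subgroup by (auto simp: residual_chain_def)
  have c: "card (F ?n) \<le> ?n"
    using card_mono[OF assms(2) subgroup.subset[OF sub]] .
  have "finite (F ?n)" using finite_subset[OF subgroup.subset[OF sub] assms(2)] .
  then have "S_subgroup (?n + l) (G\<lparr>carrier := F ?n\<rparr>) = {\<one>\<^bsub>G\<^esub>}"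
    using S_subgroup_small[OF group.subgroup_imp_group[OF assms(1) sub[of ?n]], of "?n + l"] c by simp
  then have "F (Suc ?n) \<subseteq> {\<one>\<^bsub>G\<^esub>}" using ch unfolding residual_chain_def by metis
  moreover have "\<one>\<^bsub>G\<^esub> \<in> F (Suc ?n)" using sub by (rule subgroup.one_closed)
  ultimately show False using ch unfolding residual_chain_def by blast
qed

lemma no_residual_chain_comm:
  assumes "comm_group G"
  shows "\<not> residual_chain l G F"
proof
  assume ch: "residual_chain l G F"
  have G: "group G" using assms by (rule comm_group.axioms(2))
  have sub: "subgroup (F i) G" for i
    using ch G finitely_generated_subgroup by (auto simp: residual_chain_def)
  have "comm_group (G\<lparr>carrier := F 0\<rparr>)"
  proof (rule group.group_comm_groupI[OF group.subgroup_imp_group[OF G sub]])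
    fix x y assume "x \<in> carrier (G\<lparr>carrier := F 0\<rparr>)" "y \<in> carrier (G\<lparr>carrier := F 0\<rparr>)"
    then show "x \<otimes>\<^bsub>G\<lparr>carrier := F 0\<rparr>\<^esub> y = y \<otimes>\<^bsub>G\<lparr>carrier := F 0\<rparr>\<^esub> x"
      using subgroup.mem_carrier[OF sub[of 0]] comm_monoid.m_comm[OF comm_group.axioms(1)[OF assms]] by simp
  qed
  then have "S_subgroup (0 + l) (G\<lparr>carrier := F 0\<rparr>) = {\<one>\<^bsub>G\<^esub>}"
    using S_subgroup_comm by fastforce
  then have "F (Suc 0) \<subseteq> {\<one>\<^bsub>G\<^esub>}" using ch unfolding residual_chain_def by metis
  moreover have "\<one>\<^bsub>G\<^esub> \<in> F (Suc 0)" using sub by (rule subgroup.one_closed)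
  ultimately show False using ch unfolding residual_chain_def by blast
qed

text \<open>The image of a chain in \<open>H\<close> fails to be a chain only by reaching the trivial group; from that
  term on, the chain lives in the kernel.\<close>

lemma no_residual_chain_extension:
  assumes "group_hom G H h" "\<And>l F. \<not> residual_chain l H F"
    and "\<And>l F. \<not> residual_chain l (G\<lparr>carrier := kernel G H h\<rparr>) F"
  shows "\<not> residual_chain l G F"
proof
  assume ch: "residual_chain l G F"
  interpret group_hom G H h by fact
  obtain j where j: "h ` F j = {\<one>\<^bsub>H\<^esub>}"
    using residual_chain_image[OF assms(1) ch] assms(2) by blast
  have "subgroup (F j) G"
    using ch finitely_generated_subgroup[OF G.is_group] by (auto simp: residual_chain_def)
  then have "F (0 + j) \<subseteq> kernel G H h"
    using j subgroup.subset by (fastforce simp: kernel_def)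
  from residual_chain_restrict[OF G.is_group residual_chain_tail[OF ch] subgroup_kernel this]
  show False using assms(3) by blast
qed

text \<open>A finitely generated subgroup of the union lies in one of its members, and all of the chain
  lies in its first term.\<close>

lemma no_residual_chain_union:
  fixes K :: "nat \<Rightarrow> 'a set"
  assumes "group G" "\<And>i. subgroup (K i) G" "\<And>i. K i \<subseteq> K (Suc i)" "(\<Union>i. K i) = carrier G"
    and "\<And>i l F. \<not> residual_chain l (G\<lparr>carrier := K i\<rparr>) F"
  shows "\<not> residual_chain l G F"
proof
  assume ch: "residual_chain l G F"
  have fg: "finitely_generated G (F 0)" using ch by (auto simp: residual_chain_def)
  moreover have "F 0 \<subseteq> (\<Union>i. K i)"
    using subgroup.subset[OF finitely_generated_subgroup[OF assms(1) fg]] assms(4) by simp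
  ultimately obtain m where "F 0 \<subseteq> K m"
    by (rule finitely_generated_subset_directed_union[where K = K, OF assms(1)]) (rule assms(2,3))+
  from residual_chain_restrict[OF assms(1) ch assms(2) this] assms(5) show False by blast
qed

lemma countable_group_nat_copy:
  assumes "group G" "countable (carrier G)"
  obtains Q :: "nat monoid" where "group Q" "G \<cong> Q"
proof -
  have inj: "inj_on (to_nat_on (carrier G)) (carrier G)" by (rule inj_on_to_nat_on[OF assms(2)])
  show thesis
    using that[of "image_group (to_nat_on (carrier G)) G"]
      group.inj_imp_image_group_is_group[OF assms(1) inj] inj_imp_image_group_iso[OF inj]
    by (auto simp: is_iso_def)
qed

lemma surj_hom_factor:
  assumes p: "group_hom A B p" "p ` carrier A = carrier B"
    and q: "group_hom A C q" and ker: "kernel A B p \<subseteq> kernel A C q"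
  obtains s where "group_hom B C s" "\<And>x. x \<in> carrier A \<Longrightarrow> s (p x) = q x"
proof -
  interpret p: group_hom A B p by fact
  interpret q: group_hom A C q by fact
  let ?s = "\<lambda>y. q (inv_into (carrier A) p y)"
  have eq: "q x = q y" if "x \<in> carrier A" "y \<in> carrier A" "p x = p y" for x y
  proof -
    have "x \<otimes>\<^bsub>A\<^esub> inv\<^bsub>A\<^esub> y \<in> kernel A B p" using that by (simp add: kernel_def)
    then have "x \<otimes>\<^bsub>A\<^esub> inv\<^bsub>A\<^esub> y \<in> kernel A C q" using ker by blast
    then have "q x \<otimes>\<^bsub>C\<^esub> inv\<^bsub>C\<^esub> (q y) = \<one>\<^bsub>C\<^esub>" using that by (simp add: kernel_def)
    then show ?thesis
      using q.H.inv_equality[of "q x" "inv\<^bsub>C\<^esub> (q y)"] that by (simp del: q.hom_inv)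
  qed
  have i: "inv_into (carrier A) p y \<in> carrier A" "p (inv_into (carrier A) p y) = y"
    if "y \<in> carrier B" for y
    using that p(2) by (metis inv_into_into, metis f_inv_into_f)
  have s: "?s (p x) = q x" if "x \<in> carrier A" for x
    using that i by (intro eq) auto
  have "?s \<in> hom B C"
  proof (rule homI)
    fix x y assume xy: "x \<in> carrier B" "y \<in> carrier B"
    have "?s (x \<otimes>\<^bsub>B\<^esub> y) = q (inv_into (carrier A) p x \<otimes>\<^bsub>A\<^esub> inv_into (carrier A) p y)"
      using xy i by (intro eq) auto
    then show "?s (x \<otimes>\<^bsub>B\<^esub> y) = ?s x \<otimes>\<^bsub>C\<^esub> ?s y" using xy i by simp
  qed (use i in simp)
  then have "group_hom B C ?s"
    using p.H.is_group q.H.is_group by (intro group_hom.intro group_hom_axioms.intro)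
  then show thesis using that s by blast
qed

lemma iso_FactGroup_hom:
  fixes G (structure)
  assumes "N \<lhd> G" "group Q" "G Mod N \<cong> Q"
  obtains p where "group_hom G Q p" "p ` carrier G = carrier Q" "kernel G Q p = N"
proof -
  interpret normal N G by fact
  obtain f where f: "f \<in> iso (G Mod N) Q" using assms(3) by (auto simp: is_iso_def)
  let ?p = "f \<circ> (\<lambda>x. N #>\<^bsub>G\<^esub> x)"
  have fh: "group_hom (G Mod N) Q f"
    using f factorgroup_is_group assms(2) by (auto simp: iso_def intro: group_hom.intro group_hom_axioms.intro)
  interpret f: group_hom "G Mod N" Q f by (rule fh)
  have "group_hom G Q ?p"
    using Group.hom_compose[OF r_coset_hom_Mod f.homh]
      is_group assms(2)
    by (intro group_hom.intro group_hom_axioms.intro)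
  moreover have "?p ` carrier G = carrier Q"
    using f unfolding iso_iff by (simp only: image_comp[symmetric] carrier_FactGroup)
  moreover have "kernel G Q ?p = N"
  proof -
    have "f (N #> x) = \<one>\<^bsub>Q\<^esub> \<longleftrightarrow> N #> x = N" if "x \<in> carrier G" for x
    proof -
      have "N #> x \<in> carrier (G Mod N)" using that by (auto simp: carrier_FactGroup)
      then show ?thesis
        using f f.hom_one f.G.one_closed unfolding iso_iff inj_on_def by (metis one_FactGroup)
    qed
    moreover have "N #> x = N \<longleftrightarrow> x \<in> N" if "x \<in> carrier G" for x
      using coset_join1[OF _ that subgroup_axioms] coset_join2[OF that subgroup_axioms] by blast
    ultimately have "x \<in> kernel G Q ?p \<longleftrightarrow> x \<in> N" for x
      using mem_carrier[of x] by (auto simp: kernel_def)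
    then show ?thesis by blast
  qed
  ultimately show thesis using that by blast
qed

text \<open>The induction over \<open>EA\<close> needs a property inherited by subgroups and quotients. As chains need not
  lift along surjections, the absence of chains in \<open>G\<close> itself is too weak, and all sections of \<open>G\<close>
  are considered: the images \<open>Q\<close> of homomorphisms defined on subgroups of \<open>G\<close>. Taking \<open>Q\<close> over the
  natural numbers is no restriction for countable \<open>G\<close>.\<close>

definition sections_chain_free :: "('a, 'b) monoid_scheme \<Rightarrow> bool" where
  "sections_chain_free G \<longleftrightarrow> (\<forall>H (Q :: nat monoid) h l F. subgroup H G \<longrightarrow>
     group_hom (G\<lparr>carrier := H\<rparr>) Q h \<longrightarrow> h ` H = carrier Q \<longrightarrow> \<not> residual_chain l Q F)"

lemma EA_group: "EA G \<Longrightarrow> group G"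
proof (induction rule: EA.induct)
  case (abelian G)
  then show ?case by (rule comm_group.axioms(2))
next
  case (extension N G Q)
  show ?case using extension(1) by (simp add: normal_def)
next
  case (subgroup G H)
  show ?case by (rule group.subgroup_imp_group[OF subgroup.IH subgroup.hyps(2)])
qed

text \<open>Closure under subgroups and quotients is built into the property. For extensions and unions, a
  section inherits the decomposition: the image of \<open>H\<close> is an extension of a section of \<open>G/N\<close> by a
  section of \<open>N\<close>, or the union of the images of \<open>K i \<inter> H\<close>.\<close>

lemma EA_sections_chain_free: "EA G \<Longrightarrow> sections_chain_free G"
proof (induction rule: EA.induct)
  case (finite G)
  show ?case unfolding sections_chain_free_def
  proof (intro allI impI)
    fix H Q h l F assume "subgroup H G" "group_hom (G\<lparr>carrier := H\<rparr>) (Q::nat monoid) h" "h ` H = carrier Q"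
    moreover from this have "finite H" by (intro finite_subset[OF subgroup.subset finite(2)])
    ultimately have "finite (carrier Q)" "group Q"
      by (metis finite_imageI, simp add: group_hom_def)
    then show "\<not> residual_chain l Q F" by (intro no_residual_chain_finite)
  qed
next
  case (abelian G)
  show ?case unfolding sections_chain_free_def
  proof (intro allI impI)
    fix H Q h l F
    assume H: "subgroup H G" and h: "group_hom (G\<lparr>carrier := H\<rparr>) (Q::nat monoid) h" "h ` H = carrier Q"
    interpret G: comm_group G by fact
    interpret h: group_hom "G\<lparr>carrier := H\<rparr>" Q h by fact
    have "comm_group Q"
    proof (rule h.H.group_comm_groupI)
      fix x y assume "x \<in> carrier Q" "y \<in> carrier Q"
      then obtain a b where "a \<in> H" "x = h a" "b \<in> H" "y = h b" using h(2) by blast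
      then show "x \<otimes>\<^bsub>Q\<^esub> y = y \<otimes>\<^bsub>Q\<^esub> x"
        using h.hom_mult[of a b] h.hom_mult[of b a] G.m_comm[of a b] subgroup.mem_carrier[OF H] by simp
    qed
    then show "\<not> residual_chain l Q F" by (rule no_residual_chain_comm)
  qed
next
  case (extension N G Q')
  have Q': "group Q'" using extension(3) by (rule EA_group)
  obtain p where p: "group_hom G Q' p" "kernel G Q' p = N"
    by (rule iso_FactGroup_hom[OF extension(1) Q' extension(4)])
  interpret p: group_hom G Q' p by (rule p(1))
  interpret N: normal N G by (rule extension(1))
  show ?case unfolding sections_chain_free_def
  proof (intro allI impI)
    fix H Q h l F
    assume H: "subgroup H G" and h: "group_hom (G\<lparr>carrier := H\<rparr>) (Q::nat monoid) h" "h ` H = carrier Q"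
    interpret h: group_hom "G\<lparr>carrier := H\<rparr>" Q h by fact
    have HN: "N \<inter> H \<lhd> G\<lparr>carrier := H\<rparr>" by (rule p.G.normal_Int_subgroup[OF H extension(1)])
    have Y: "h ` (N \<inter> H) \<lhd> Q"
      by (rule normal.surj_hom_normal_subgroup[OF HN h(1)]) (simp add: h(2))
    interpret Y: normal "h ` (N \<inter> H)" Q by (rule Y)
    \<comment> \<open>sections range over groups on the natural numbers, whereas this quotient consists of cosets\<close>
    obtain Z :: "nat monoid" where Z: "group Z" "Q Mod h ` (N \<inter> H) \<cong> Z"
      by (rule countable_group_nat_copy[OF Y.factorgroup_is_group])
         (auto simp: carrier_FactGroup)
    obtain r where r: "group_hom Q Z r" "r ` carrier Q = carrier Z" "kernel Q Z r = h ` (N \<inter> H)"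
      by (rule iso_FactGroup_hom[OF Y Z])
    interpret r: group_hom Q Z r by (rule r(1))
    \<comment> \<open>\<open>Z\<close> is a section of \<open>Q'\<close>: the map \<open>r \<circ> h\<close> kills \<open>N \<inter> H\<close>, so it factors through \<open>p ` H\<close>\<close>
    have rh: "group_hom (G\<lparr>carrier := H\<rparr>) Z (r \<circ> h)"
      using Group.hom_compose[OF h.homh r.homh] by (intro group_hom.intro group_hom_axioms.intro h.G.is_group Z)
    have pH: "group_hom (G\<lparr>carrier := H\<rparr>) (Q'\<lparr>carrier := p ` H\<rparr>) p"
      by (rule p.induced_group_hom[OF H])
    have "kernel (G\<lparr>carrier := H\<rparr>) (Q'\<lparr>carrier := p ` H\<rparr>) p \<subseteq> kernel (G\<lparr>carrier := H\<rparr>) Z (r \<circ> h)"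
    proof
      fix x assume "x \<in> kernel (G\<lparr>carrier := H\<rparr>) (Q'\<lparr>carrier := p ` H\<rparr>) p"
      then have x: "x \<in> H" "x \<in> N" using p(2) subgroup.subset[OF H] by (auto simp: kernel_def)
      then have "h x \<in> kernel Q Z r" using r(3) by blast
      then show "x \<in> kernel (G\<lparr>carrier := H\<rparr>) Z (r \<circ> h)" using x by (simp add: kernel_def)
    qed
    then obtain s where s: "group_hom (Q'\<lparr>carrier := p ` H\<rparr>) Z s" "\<And>x. x \<in> H \<Longrightarrow> s (p x) = r (h x)"
      using surj_hom_factor[OF pH _ rh] by auto
    have "s ` p ` H = r ` h ` H" unfolding image_image using s(2) by (rule image_cong[OF refl])
    then have "s ` p ` H = carrier Z" using h(2) r(2) by simp
    then have Zfree: "\<not> residual_chain l Z F" for l F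
      using extension.IH(2) p.subgroup_img_is_subgroup[OF H] s(1) unfolding sections_chain_free_def by blast
    have HNG: "subgroup (N \<inter> H) G" using N.subgroup_axioms H by (rule p.G.subgroups_Inter_pair)
    have sHN: "subgroup (N \<inter> H) (G\<lparr>carrier := N\<rparr>)"
      by (rule p.G.subgroup_incl[OF HNG N.subgroup_axioms]) blast
    have "\<not> residual_chain l (Q\<lparr>carrier := h ` (N \<inter> H)\<rparr>) F" for l F
      using extension.IH(1) sHN h.induced_group_hom[OF normal_imp_subgroup[OF HN]]
      unfolding sections_chain_free_def by simp
    then show "\<not> residual_chain l Q F"
      using no_residual_chain_extension[OF r(1) Zfree] r(3) by simp
  qed
next
  case (increasing_union G K)
  interpret G: group G by fact
  show ?case unfolding sections_chain_free_def
  proof (intro allI impI)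
    fix H Q h l F
    assume H: "subgroup H G" and h: "group_hom (G\<lparr>carrier := H\<rparr>) (Q::nat monoid) h" "h ` H = carrier Q"
    interpret h: group_hom "G\<lparr>carrier := H\<rparr>" Q h by fact
    have KG: "subgroup (K i \<inter> H) G" for i
      using G.subgroups_Inter_pair[OF increasing_union(2) H] .
    have KH: "subgroup (K i \<inter> H) (G\<lparr>carrier := H\<rparr>)" for i
      by (rule G.subgroup_incl[OF KG H]) blast
    have KK: "subgroup (K i \<inter> H) (G\<lparr>carrier := K i\<rparr>)" for i
      by (rule G.subgroup_incl[OF KG increasing_union(2)]) blast
    show "\<not> residual_chain l Q F"
    proof (rule no_residual_chain_union[where K = "\<lambda>i. h ` (K i \<inter> H)"])
      show "subgroup (h ` (K i \<inter> H)) Q" for i by (rule h.subgroup_img_is_subgroup[OF KH])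
      show "h ` (K i \<inter> H) \<subseteq> h ` (K (Suc i) \<inter> H)" for i using increasing_union(3)[of i] by blast
      have "(\<Union>i. h ` (K i \<inter> H)) = h ` H"
        using increasing_union(4) subgroup.subset[OF H] by blast
      then show "(\<Union>i. h ` (K i \<inter> H)) = carrier Q" using h(2) by simp
      show "\<not> residual_chain l (Q\<lparr>carrier := h ` (K i \<inter> H)\<rparr>) F" for i l F
        using increasing_union.IH[of i] KK[of i] h.induced_group_hom[OF KH[of i]]
        unfolding sections_chain_free_def by simp
    qed (rule h.H.is_group)
  qed
next
  case (subgroup G H)
  interpret G: group G using subgroup(1) by (rule EA_group)
  show ?case unfolding sections_chain_free_def
  proof (intro allI impI)
    fix K Q h l F
    assume K: "subgroup K (G\<lparr>carrier := H\<rparr>)"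
      and h: "group_hom (G\<lparr>carrier := H, carrier := K\<rparr>) (Q::nat monoid) h" "h ` K = carrier Q"
    have "subgroup K G" by (rule G.incl_subgroup[OF subgroup(2) K])
    then show "\<not> residual_chain l Q F" using h subgroup.IH unfolding sections_chain_free_def by simp
  qed
next
  case (quotient G N Q')
  interpret G: group G using quotient(1) by (rule EA_group)
  obtain p where p: "group_hom G Q' p" "p ` carrier G = carrier Q'"
    by (rule iso_FactGroup_hom[OF quotient(2,3,4)])
  interpret p: group_hom G Q' p by (rule p(1))
  show ?case unfolding sections_chain_free_def
  proof (intro allI impI)
    fix K Q h l F
    assume K: "subgroup K Q'"
      and h: "group_hom (Q'\<lparr>carrier := K\<rparr>) (Q::nat monoid) h" "h ` K = carrier Q"
    interpret h: group_hom "Q'\<lparr>carrier := K\<rparr>" Q h by (rule h(1))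
    \<comment> \<open>a section of the quotient is a section of \<open>G\<close>, defined on the preimage\<close>
    let ?L = "{x \<in> carrier G. p x \<in> K}"
    have L: "subgroup ?L G"
      by (rule G.subgroupI)
         (auto simp: subgroup.m_closed[OF K] subgroup.m_inv_closed[OF K] subgroup.one_closed[OF K] intro!: exI[of _ "\<one>\<^bsub>G\<^esub>"])
    have "K \<subseteq> p ` carrier G" using p(2) subgroup.subset[OF K] by simp
    then have pL: "p ` ?L = K" by auto
    have "group_hom (G\<lparr>carrier := ?L\<rparr>) Q (h \<circ> p)"
      using Group.hom_compose[OF group_hom.homh[OF p.induced_group_hom[OF L, unfolded pL]] h.homh]
        G.subgroup_imp_group[OF L] h.H.is_group by (intro group_hom.intro group_hom_axioms.intro)
    moreover have "(h \<circ> p) ` ?L = carrier Q" by (simp only: image_comp[symmetric] pL h(2))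
    ultimately show "\<not> residual_chain l Q F"
      using quotient.IH L unfolding sections_chain_free_def by metis
  qed
qed

text \<open>An isomorphism onto a group over the natural numbers carries a chain to a chain, and every group
  is a section of itself.\<close>

theorem elementary_amenable_no_residual_chain:
  assumes "elementary_amenable G"
  shows "\<not> residual_chain l G F"
proof
  assume ch: "residual_chain l G F"
  obtain H f where H: "EA H" "f \<in> iso G H" and G: "group G"
    using assms unfolding elementary_amenable_def is_iso_def by blast
  interpret H: group H using H(1) by (rule EA_group)
  interpret f: group_hom G H f
    using H(2) G H.is_group by (auto simp: iso_def intro: group_hom.intro group_hom_axioms.intro)
  have "f ` F i \<noteq> {\<one>\<^bsub>H\<^esub>}" for i
  proof
    have F: "subgroup (F i) G" "F i \<noteq> {\<one>\<^bsub>G\<^esub>}"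
      using ch finitely_generated_subgroup[OF G] by (auto simp: residual_chain_def)
    assume "f ` F i = {\<one>\<^bsub>H\<^esub>}"
    then have "x = \<one>\<^bsub>G\<^esub>" if "x \<in> F i" for x
      using that H(2) f.iso_iff subgroup.mem_carrier[OF F(1)] by blast
    with F subgroup.one_closed[OF F(1)] show False by blast
  qed
  from residual_chain_image[OF f.group_hom_axioms ch this]
  have "residual_chain l H (\<lambda>i. f ` F i)" .
  moreover have "group_hom (H\<lparr>carrier := carrier H\<rparr>) H id"
    by (rule H.canonical_inj_is_hom[OF H.subgroup_self])
  ultimately show False
    using EA_sections_chain_free[OF H(1)] H.subgroup_self
    unfolding sections_chain_free_def
    by (elim allE[of _ "carrier H"] allE[of _ H] allE[of _ id]) simp
qed

section \<open>Subgroups of small index in finitely generated groups\<close>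

lemma (in group) r_coset_eq_iff:
  assumes "subgroup H G" "x \<in> carrier G" "y \<in> carrier G"
  shows "H #> x = H #> y \<longleftrightarrow> x \<otimes> inv y \<in> H"
proof
  have H: "H \<subseteq> carrier G" and xy: "x \<otimes> inv y \<in> carrier G"
    using assms subgroup.subset by auto
  show "x \<otimes> inv y \<in> H" if "H #> x = H #> y"
    using coset_join1[OF coset_mult_inv2[OF that assms(2,3) H] xy assms(1)] .
  show "H #> x = H #> y" if "x \<otimes> inv y \<in> H"
    using coset_mult_inv1[OF coset_join2[OF xy assms(1) that] assms(2,3) H] .
qed

text \<open>Numbering the cosets makes different subgroups comparable: their coset spaces become subsets
  of one finite set.\<close>

lemma (in group) coset_labelling:
  assumes "finite (rcosets H)" "card (rcosets H) \<le> n"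
  obtains f :: "'a \<Rightarrow> nat" where "f ` carrier G \<subseteq> {..<n}"
    "\<And>x y. x \<in> carrier G \<Longrightarrow> y \<in> carrier G \<Longrightarrow> f x = f y \<longleftrightarrow> H #> x = H #> y"
proof -
  obtain c where c: "bij_betw c (rcosets H) {0..<card (rcosets H)}"
    using ex_bij_betw_finite_nat[OF assms(1)] by blast
  have mem: "H #> x \<in> rcosets H" if "x \<in> carrier G" for x using that by (auto simp: RCOSETS_def)
  show thesis
  proof
    show "(\<lambda>x. c (H #> x)) ` carrier G \<subseteq> {..<n}"
      using bij_betwE[OF c] mem assms(2) by fastforce
    show "c (H #> x) = c (H #> y) \<longleftrightarrow> H #> x = H #> y" if "x \<in> carrier G" "y \<in> carrier G" for x y
      using inj_on_eq_iff[OF bij_betw_imp_inj_on[OF c]] mem that by blast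
  qed
qed

text \<open>The labelled Schreier coset graph: the vertices are the labels of the cosets, and each \<open>a \<in> A\<close>
  gives an edge from the coset of \<open>x\<close> to that of \<open>x a\<close>.\<close>

definition schreier_edges :: "('a, 'b) monoid_scheme \<Rightarrow> 'a set \<Rightarrow> ('a \<Rightarrow> 'c) \<Rightarrow> ('a \<times> 'c \<times> 'c) set" where
  "schreier_edges G A f = {(a, f x, f (x \<otimes>\<^bsub>G\<^esub> a)) | a x. a \<in> A \<and> x \<in> carrier G}"

text \<open>A word in the generators is a walk in the Schreier graph, so its endpoint is determined by the
  graph and the starting vertex.\<close>

lemma (in group) schreier_edges_determine_labels:
  assumes A: "A \<subseteq> carrier G" and HH': "subgroup H G" "subgroup H' G"
    and f: "\<And>x y. x \<in> carrier G \<Longrightarrow> y \<in> carrier G \<Longrightarrow> f x = f y \<longleftrightarrow> H #> x = H #> y"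
    and f': "\<And>x y. x \<in> carrier G \<Longrightarrow> y \<in> carrier G \<Longrightarrow> f' x = f' y \<longleftrightarrow> H' #> x = H' #> y"
    and edges: "schreier_edges G A f = schreier_edges G A f'"
    and w: "w \<in> generate G A"
  shows "x \<in> carrier G \<Longrightarrow> y \<in> carrier G \<Longrightarrow> f x = f' y \<Longrightarrow> f (x \<otimes> w) = f' (y \<otimes> w)"
  using w
proof (induction w arbitrary: x y rule: generate.induct)
  case (incl a)
  then have a: "a \<in> carrier G" using A by blast
  have "(a, f x, f (x \<otimes> a)) \<in> schreier_edges G A f'"
    unfolding edges[symmetric] using incl unfolding schreier_edges_def by blast
  then obtain z where z: "z \<in> carrier G" "f x = f' z" "f (x \<otimes> a) = f' (z \<otimes> a)"
    by (auto simp: schreier_edges_def)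
  then have "H' #> z = H' #> y" using f' incl by simp
  then have "H' #> (z \<otimes> a) = H' #> (y \<otimes> a)"
    using coset_mult_assoc[OF subgroup.subset[OF HH'(2)]] z(1) incl a by metis
  then show ?case using z f' a incl by simp
next
  case (inv a)
  then have a: "a \<in> carrier G" using A by blast
  \<comment> \<open>an inverse generator traverses an edge backwards, from the coset of \<open>x\<close> to that of \<open>?u\<close>\<close>
  let ?u = "x \<otimes> inv a"
  have u: "?u \<in> carrier G" "?u \<otimes> a = x" using a inv by (simp_all add: m_assoc)
  have "(a, f ?u, f (?u \<otimes> a)) \<in> schreier_edges G A f'"
    unfolding edges[symmetric] using inv u unfolding schreier_edges_def by blast
  then obtain z where z: "z \<in> carrier G" "f ?u = f' z" "f x = f' (z \<otimes> a)"
    using u(2) by (auto simp: schreier_edges_def)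
  then have "H' #> (z \<otimes> a) = H' #> y" using f' inv a by simp
  then have "H' #> (z \<otimes> a \<otimes> inv a) = H' #> (y \<otimes> inv a)"
    using coset_mult_assoc[OF subgroup.subset[OF HH'(2)]] z(1) inv a by (metis inv_closed m_closed)
  then have "f' z = f' (y \<otimes> inv a)" using z(1) f' a inv by (simp add: m_assoc)
  then show ?case using z by simp
next
  case (eng v w)
  have "v \<in> carrier G" "w \<in> carrier G" using eng A generate_in_carrier by auto
  then show ?case using eng.IH(2)[OF _ _ eng.IH(1)] eng.prems by (simp add: m_assoc[symmetric])
qed simp

text \<open>A subgroup is the set of words whose walk from the base vertex is closed. It is thus recovered
  from its labelled Schreier graph and base vertex, for which there are finitely many possibilities.\<close>

theorem (in group) finite_subgroups_bounded_index:
  assumes "finite A" "A \<subseteq> carrier G" "generate G A = carrier G"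
  shows "finite {H. subgroup H G \<and> finite (rcosets H) \<and> card (rcosets H) \<le> n}"
proof -
  let ?M = "{H. subgroup H G \<and> finite (rcosets H) \<and> card (rcosets H) \<le> n}"
  have "\<forall>H\<in>?M. \<exists>f :: 'a \<Rightarrow> nat. f ` carrier G \<subseteq> {..<n} \<and>
      (\<forall>x\<in>carrier G. \<forall>y\<in>carrier G. f x = f y \<longleftrightarrow> H #> x = H #> y)"
    by (safe, rule coset_labelling) blast+
  from bchoice[OF this] obtain f :: "'a set \<Rightarrow> 'a \<Rightarrow> nat"
    where ff: "\<forall>H\<in>?M. f H ` carrier G \<subseteq> {..<n} \<and>
      (\<forall>x\<in>carrier G. \<forall>y\<in>carrier G. f H x = f H y \<longleftrightarrow> H #> x = H #> y)" ..
  have f: "f H ` carrier G \<subseteq> {..<n}"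
      "\<And>x y. x \<in> carrier G \<Longrightarrow> y \<in> carrier G \<Longrightarrow> f H x = f H y \<longleftrightarrow> H #> x = H #> y"
    if "H \<in> ?M" for H
    using bspec[OF ff that] by simp_all
  \<comment> \<open>the base vertex together with the Schreier graph\<close>
  let ?D = "\<lambda>H. (f H \<one>, schreier_edges G A (f H))"
  have "inj_on ?D ?M"
  proof (rule inj_onI)
    fix H K assume H: "H \<in> ?M" and K: "K \<in> ?M" and eq: "?D H = ?D K"
    have s: "subgroup H G" "subgroup K G" using H K by auto
    have "w \<in> H \<longleftrightarrow> w \<in> K" if w: "w \<in> carrier G" for w
    proof -
      have "f H (\<one> \<otimes> w) = f K (\<one> \<otimes> w)"
        by (rule schreier_edges_determine_labels[OF assms(2) s f(2)[OF H] f(2)[OF K]])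
           (use eq w assms(3) in auto)
      then have "f H w = f H \<one> \<longleftrightarrow> f K w = f K \<one>" using eq w by simp
      then show ?thesis using f(2)[OF H w] f(2)[OF K w] r_coset_eq_iff s w by simp
    qed
    then show "H = K" using subgroup.subset[OF s(1)] subgroup.subset[OF s(2)] by blast
  qed
  moreover have "?D ` ?M \<subseteq> {..<n} \<times> Pow (A \<times> {..<n} \<times> {..<n})"
  proof (rule image_subsetI)
    fix H assume "H \<in> ?M"
    then have l: "f H x < n" if "x \<in> carrier G" for x using f(1) that by blast
    then show "?D H \<in> {..<n} \<times> Pow (A \<times> {..<n} \<times> {..<n})"
      using assms(2) by (auto simp: schreier_edges_def)
  qed
  ultimately show ?thesis
    using assms(1) by (meson finite_Pow_iff finite_SigmaI finite_lessThan inj_on_finite)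
qed

section \<open>Elementary amenability passes up from the residual subgroup\<close>

lemma S_subgroup_normal:
  assumes "group G"
  shows "S_subgroup k G \<lhd> G"
proof -
  interpret group G by fact
  show ?thesis
    unfolding normal_inv_iff
  proof (intro conjI ballI S_subgroup_subgroup[OF assms])
    fix x h assume x: "x \<in> carrier G" and h: "h \<in> S_subgroup k G"
    have "x \<otimes>\<^bsub>G\<^esub> h \<otimes>\<^bsub>G\<^esub> inv\<^bsub>G\<^esub> x \<in> M" if "M \<lhd> G" "h \<in> M" for M
      using that x unfolding normal_inv_iff by blast
    then show "x \<otimes>\<^bsub>G\<^esub> h \<otimes>\<^bsub>G\<^esub> inv\<^bsub>G\<^esub> x \<in> S_subgroup k G"
      using h derived_self_is_normal unfolding S_subgroup_def by blast
  qed
qed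

lemma finite_image_factor:
  assumes "finite (f ` D)" "\<And>x y. x \<in> D \<Longrightarrow> y \<in> D \<Longrightarrow> f x = f y \<Longrightarrow> g x = g y"
  shows "finite (g ` D)"
proof (rule finite_subset)
  show "g ` D \<subseteq> (\<lambda>v. g (inv_into D f v)) ` f ` D"
  proof
    fix z assume "z \<in> g ` D"
    then obtain x where x: "x \<in> D" "z = g x" by blast
    then have "g (inv_into D f (f x)) = g x"
      using assms(2) by (metis f_inv_into_f imageI inv_into_into)
    then show "z \<in> (\<lambda>v. g (inv_into D f v)) ` f ` D" using x by force
  qed
qed (use assms(1) in simp)

text \<open>Without finite generation the index may be infinite: then infinitely many normal subgroups of
  bounded index can be involved. Here there are finitely many, and an element of \<open>[G, G]\<close> is
  determined modulo \<open>S_subgroup k G\<close> by its cosets of each of them.\<close>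

lemma finite_index_S_subgroup_in_derived:
  assumes "group G" "finite A" "A \<subseteq> carrier G" "generate G A = carrier G"
  shows "finite (rcosets\<^bsub>G\<lparr>carrier := derived G (carrier G)\<rparr>\<^esub> S_subgroup k G)"
proof -
  interpret group G by fact
  let ?D = "derived G (carrier G)" and ?S = "S_subgroup k G"
  let ?M = "{M. M \<lhd> G \<and> finite (rcosets\<^bsub>G\<^esub> M) \<and> card (rcosets\<^bsub>G\<^esub> M) \<le> k + 1}"
  let ?f = "\<lambda>x. \<lambda>M\<in>?M. M #>\<^bsub>G\<^esub> x"
  have D: "?D \<subseteq> carrier G" "subgroup ?D G"
    using derived_in_carrier derived_is_subgroup by auto
  have "finite ?M"
    by (rule finite_subset[OF _ finite_subgroups_bounded_index[OF assms(2-4), of "k + 1"]])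
       (auto simp: normal_imp_subgroup)
  then have fin: "finite (PiE ?M (\<lambda>M. rcosets\<^bsub>G\<^esub> M))" by (intro finite_PiE) auto
  have "?f ` ?D \<subseteq> PiE ?M (\<lambda>M. rcosets\<^bsub>G\<^esub> M)"
  proof (rule image_subsetI, rule restrict_PiE_iff[THEN iffD2], rule ballI)
    fix x M assume "x \<in> ?D" "M \<in> ?M"
    then show "M #>\<^bsub>G\<^esub> x \<in> rcosets\<^bsub>G\<^esub> M" using D(1) unfolding RCOSETS_def by blast
  qed
  then have "finite (?f ` ?D)" using fin by (rule finite_subset)
  then have "finite ((\<lambda>x. ?S #>\<^bsub>G\<^esub> x) ` ?D)"
  proof (rule finite_image_factor)
    fix x y assume xy: "x \<in> ?D" "y \<in> ?D" and eq: "?f x = ?f y"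
    have "x \<otimes>\<^bsub>G\<^esub> inv\<^bsub>G\<^esub> y \<in> M" if M: "M \<in> ?M" for M
    proof -
      have "M #>\<^bsub>G\<^esub> x = M #>\<^bsub>G\<^esub> y" using fun_cong[OF eq, of M] M by simp
      then show ?thesis
        using r_coset_eq_iff[OF normal_imp_subgroup, of M x y] M xy D(1) by blast
    qed
    moreover have "x \<otimes>\<^bsub>G\<^esub> inv\<^bsub>G\<^esub> y \<in> ?D"
      using xy D(2) by (simp add: subgroup.m_closed subgroup.m_inv_closed)
    ultimately have "x \<otimes>\<^bsub>G\<^esub> inv\<^bsub>G\<^esub> y \<in> ?S" unfolding S_subgroup_def by blast
    then show "?S #>\<^bsub>G\<^esub> x = ?S #>\<^bsub>G\<^esub> y"
      using r_coset_eq_iff[OF S_subgroup_subgroup[OF assms(1)]] xy D(1) by blast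
  qed
  moreover have "rcosets\<^bsub>G\<lparr>carrier := ?D\<rparr>\<^esub> ?S = (\<lambda>x. ?S #>\<^bsub>G\<^esub> x) ` ?D"
    by (auto simp: RCOSETS_def)
  ultimately show ?thesis by simp
qed

lemma EA_iso: "EA G \<Longrightarrow> group H \<Longrightarrow> G \<cong> H \<Longrightarrow> EA H"
  using EA.quotient[of G "{\<one>\<^bsub>G\<^esub>}" H] EA_group group.one_is_normal
    iso_trans[OF is_isoI[OF group.trivial_factor_iso]] by blast

text \<open>The series \<open>S_subgroup k G \<le> [G, G] \<le> G\<close> has a finite and an abelian factor.\<close>

lemma EA_of_S_subgroup:
  assumes "group G" "finitely_generated G (carrier G)" "EA (G\<lparr>carrier := S_subgroup k G\<rparr>)"
  shows "EA G"
proof -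
  interpret group G by fact
  obtain A where A: "finite A" "A \<subseteq> carrier G" "generate G A = carrier G"
    using assms(2) by (auto simp: finitely_generated_def)
  let ?D = "derived G (carrier G)"
  have D: "subgroup ?D G" by (rule derived_is_subgroup) simp
  have S: "S_subgroup k G \<lhd> G\<lparr>carrier := ?D\<rparr>"
    by (rule normal_restrict_supergroup[OF D S_subgroup_normal[OF assms(1)]]) (auto simp: S_subgroup_def)
  have EAD: "EA (G\<lparr>carrier := ?D\<rparr>)"
  proof -
    have fin: "finite (carrier ((G\<lparr>carrier := ?D\<rparr>) Mod S_subgroup k G))"
      using finite_index_S_subgroup_in_derived[OF assms(1) A] by (simp add: FactGroup_def)
    obtain Q :: "nat monoid" where Q: "group Q" "(G\<lparr>carrier := ?D\<rparr>) Mod S_subgroup k G \<cong> Q"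
      by (rule countable_group_nat_copy[OF normal.factorgroup_is_group[OF S] countable_finite[OF fin]])
    have "EA Q" using Q fin iso_finite by (intro EA.finite) auto
    then show ?thesis using EA.extension[OF S _ _ Q(2)] assms(3) by simp
  qed
  obtain Q :: "nat monoid" where Q: "group Q" "G Mod ?D \<cong> Q"
    by (rule countable_group_nat_copy[OF derived_quot_is_group]) (simp add: carrier_FactGroup)
  have "comm_group Q"
    by (rule comm_group.iso_imp_comm_group[OF derived_quot_is_comm_group Q(2)])
       (rule group.is_monoid[OF Q(1)])
  then have "EA Q" by (rule EA.abelian)
  then show ?thesis using EA.extension[OF derived_self_is_normal EAD _ Q(2)] by simp
qed

section \<open>Decomposition trees\<close>

lemma group_Mod_free: "N \<lhd> free_grp \<Longrightarrow> group (free_grp Mod N)"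
  by (rule normal.factorgroup_is_group)

lemma countable_Mod_free: "countable (carrier (free_grp Mod N))"
  by (simp add: carrier_FactGroup)

abbreviation generated_R :: "(nat \<Rightarrow> word) \<Rightarrow> word set \<Rightarrow> nat \<Rightarrow> word set set" where
  "generated_R \<gamma> N n \<equiv> generate (free_grp Mod N) (menum \<gamma> N ` {0..n})"

lemma menum_image:
  assumes "N \<lhd> free_grp" "range \<gamma> = carrier free_grp"
  shows "range (menum \<gamma> N) = carrier (free_grp Mod N)"
proof -
  have "range (menum \<gamma> N) = mproj N ` range \<gamma>" by (auto simp: menum_def)
  then show ?thesis by (simp add: assms(2) carrier_FactGroup mproj_def[abs_def])
qed

lemma finitely_generated_R:
  assumes "N \<lhd> free_grp" "range \<gamma> = carrier free_grp"
  shows "finitely_generated (free_grp Mod N) (generated_R \<gamma> N n)"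
  unfolding finitely_generated_def using menum_image[OF assms] by blast

lemma marked_R_normal:
  assumes "N \<lhd> free_grp" "range \<gamma> = carrier free_grp"
  shows "marked_R \<gamma> n N \<lhd> free_grp"
  unfolding marked_R_def mark_generated_def
  using assms group.is_monoid[OF group_free_grp] by (intro mark_along_normal) auto

lemma marked_S_normal:
  assumes "N \<lhd> free_grp" "range \<gamma> = carrier free_grp"
  shows "marked_S \<gamma> k N \<lhd> free_grp"
  unfolding marked_S_def mark_subgroup_def
  using assms group.is_monoid[OF group_free_grp] by (intro mark_along_normal) auto

lemma decomp_group_normal:
  assumes "N \<lhd> free_grp" "range \<gamma> = carrier free_grp"
  shows "decomp_group \<gamma> l N s \<lhd> free_grp"
proof (induction s rule: rev_induct)
  case Nil
  show ?case using assms(1) by (simp add: decomp_group_Nil)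
next
  case (snoc n s)
  show ?case unfolding decomp_group_snoc
    by (intro marked_S_normal marked_R_normal snoc.IH assms(2))
qed

text \<open>This removes the markings: up to isomorphism, a child in the tree is a subgroup of its parent,
  and the enumeration only serves to list the finitely generated subgroups \<open>generated_R \<gamma> N n\<close>.\<close>

lemma marked_S_R_iso:
  assumes "N \<lhd> free_grp" "range \<gamma> = carrier free_grp"
  shows "free_grp Mod marked_S \<gamma> k (marked_R \<gamma> n N) \<cong> (free_grp Mod N)\<lparr>carrier :=
    S_subgroup k ((free_grp Mod N)\<lparr>carrier := generated_R \<gamma> N n\<rparr>)\<rparr>"
proof -
  let ?R = "marked_R \<gamma> n N" and ?G = "(free_grp Mod N)\<lparr>carrier := generated_R \<gamma> N n\<rparr>"
  have R: "?R \<lhd> free_grp" by (rule marked_R_normal[OF assms])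
  have gR: "group (free_grp Mod ?R)" by (rule group_Mod_free[OF R])
  have gG: "group ?G"
    by (rule group.subgroup_imp_group[OF group_Mod_free[OF assms(1)]
          finitely_generated_subgroup[OF group_Mod_free[OF assms(1)] finitely_generated_R[OF assms]]])
  obtain f where f: "f \<in> iso (free_grp Mod ?R) ?G"
    using marked_R_iso[OF assms] unfolding is_iso_def by blast
  have "free_grp Mod marked_S \<gamma> k ?R \<cong> (free_grp Mod ?R)\<lparr>carrier := S_subgroup k (free_grp Mod ?R)\<rparr>"
    unfolding marked_S_def by (rule mark_subgroup_iso[OF R assms(2) S_subgroup_subgroup[OF gR]])
  also have "\<dots> \<cong> ?G\<lparr>carrier := S_subgroup k ?G\<rparr>"
    using iso_restrict[OF f gR gG S_subgroup_subgroup[OF gR]]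
    unfolding S_subgroup_iso_image[OF gR gG f] by (rule is_isoI)
  finally show ?thesis by simp
qed

lemma elementary_amenable_iso:
  assumes "elementary_amenable G" "group H" "G \<cong> H"
  shows "elementary_amenable H"
  using assms group.iso_sym iso_trans unfolding elementary_amenable_def by blast

lemma elementary_amenable_nat: "elementary_amenable (G :: nat monoid) \<longleftrightarrow> EA G"
  using EA_group EA_iso group.iso_sym iso_refl unfolding elementary_amenable_def by blast

text \<open>The group is the increasing union of its subgroups generated by initial segments of the
  enumeration, and each of these is elementary amenable because its residual subgroup is.\<close>

lemma elementary_amenable_of_decomposition:
  assumes N: "N \<lhd> free_grp" "range \<gamma> = carrier free_grp"
    and ea: "\<And>n. elementary_amenable (free_grp Mod marked_S \<gamma> k (marked_R \<gamma> n N))"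
  shows "elementary_amenable (free_grp Mod N)"
proof -
  let ?G = "free_grp Mod N" and ?H = "generated_R \<gamma> N"
  have G: "group ?G" by (rule group_Mod_free[OF N(1)])
  obtain Q :: "nat monoid" where Q: "group Q" "?G \<cong> Q"
    by (rule countable_group_nat_copy[OF G countable_Mod_free])
  obtain f where f: "f \<in> iso ?G Q" using Q(2) unfolding is_iso_def by blast
  have fh: "group_hom ?G Q f"
    using f G Q(1) by (intro group_hom.intro group_hom_axioms.intro) (simp_all add: iso_imp_homomorphism)
  have H: "subgroup (?H n) ?G" for n
    by (rule finitely_generated_subgroup[OF G finitely_generated_R[OF N]])
  have fH: "subgroup (f ` ?H n) Q" for n by (rule group_hom.subgroup_img_is_subgroup[OF fh H])
  have "EA (Q\<lparr>carrier := f ` ?H n\<rparr>)" for n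
  proof -
    let ?GH = "?G\<lparr>carrier := ?H n\<rparr>" and ?QH = "Q\<lparr>carrier := f ` ?H n\<rparr>"
    have g: "group ?GH" "group ?QH"
      by (rule group.subgroup_imp_group[OF G H], rule group.subgroup_imp_group[OF Q(1) fH])
    have r: "restrict f (?H n) \<in> iso ?GH ?QH" by (rule iso_restrict[OF f G Q(1) H])
    have "free_grp Mod marked_S \<gamma> k (marked_R \<gamma> n N) \<cong> ?GH\<lparr>carrier := S_subgroup k ?GH\<rparr>"
      using marked_S_R_iso[OF N] by simp
    also have "\<dots> \<cong> ?QH\<lparr>carrier := S_subgroup k ?QH\<rparr>"
      using iso_restrict[OF r g S_subgroup_subgroup[OF g(1)]]
      unfolding S_subgroup_iso_image[OF g r] by (rule is_isoI)
    finally have "EA (?QH\<lparr>carrier := S_subgroup k ?QH\<rparr>)"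
      using elementary_amenable_iso[OF ea group.subgroup_imp_group[OF g(2) S_subgroup_subgroup[OF g(2)]]]
        elementary_amenable_nat by blast
    moreover have "finitely_generated ?QH (carrier ?QH)"
      using finitely_generated_restrict[OF Q(1) fH finitely_generated_image[OF fh finitely_generated_R[OF N]]]
      by simp
    ultimately show "EA ?QH" using EA_of_S_subgroup[OF g(2)] by blast
  qed
  moreover have "f ` ?H n \<subseteq> f ` ?H (Suc n)" for n
    by (intro image_mono group.mono_generate[OF G]) auto
  moreover have "(\<Union>n. f ` ?H n) = carrier Q"
  proof -
    have "carrier ?G \<subseteq> (\<Union>n. ?H n)"
    proof
      fix g assume "g \<in> carrier ?G"
      then obtain n where "g = menum \<gamma> N n" using menum_image[OF N] by blast
      then have "g \<in> ?H n" by (intro generate.incl) auto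
      then show "g \<in> (\<Union>n. ?H n)" by blast
    qed
    moreover have "(\<Union>n. ?H n) \<subseteq> carrier ?G" using subgroup.subset[OF H] by blast
    ultimately have "(\<Union>n. ?H n) = carrier ?G" by blast
    moreover have "f ` carrier ?G = carrier Q" using f by (simp add: iso_iff)
    ultimately show ?thesis by (metis image_UN)
  qed
  ultimately have "EA Q"
    by (intro EA.increasing_union[where H = "\<lambda>n. f ` ?H n", OF Q(1) fH])
  then show ?thesis
    using elementary_amenable_iso[OF _ G group.iso_sym[OF G Q(2)]] elementary_amenable_nat by blast
qed

text \<open>If the group at a vertex is not elementary amenable, then neither is the group at one of the
  children. Following such children from the root yields an infinite branch.\<close>

theorem elementary_amenable_of_well_founded:
  assumes N: "N \<lhd> free_grp" "range \<gamma> = carrier free_grp"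
    and wf: "well_founded_tree (decomp_tree \<gamma> l N)"
  shows "elementary_amenable (free_grp Mod N)"
proof (rule ccontr)
  let ?ea = "\<lambda>s. elementary_amenable (free_grp Mod decomp_group \<gamma> l N s)"
  assume "\<not> ?thesis"
  then have nil: "\<not> ?ea []" by (simp add: decomp_group_Nil)
  define pick where "pick s = (SOME n. \<not> ?ea (s @ [n]))" for s
  have pick: "\<not> ?ea (s @ [pick s])" if "\<not> ?ea s" for s
  proof -
    have "\<exists>n. \<not> ?ea (s @ [n])"
      using that elementary_amenable_of_decomposition[OF decomp_group_normal[OF N] N(2)]
      unfolding decomp_group_snoc by blast
    then show ?thesis unfolding pick_def by (rule someI_ex)
  qed
  define path where "path = rec_nat [] (\<lambda>_ s. s @ [pick s])"
  have path: "path 0 = []" "path (Suc m) = path m @ [pick (path m)]" for m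
    by (simp_all add: path_def)
  have not_ea: "\<not> ?ea (path m)" for m
    by (induction m) (simp_all add: path nil pick)
  have nontrivial: "carrier (free_grp Mod decomp_group \<gamma> l N s) \<noteq> {\<one>\<^bsub>free_grp Mod decomp_group \<gamma> l N s\<^esub>}"
    if "\<not> ?ea s" for s
  proof
    let ?G = "free_grp Mod decomp_group \<gamma> l N s"
    assume triv: "carrier ?G = {\<one>\<^bsub>?G\<^esub>}"
    have G: "group ?G" by (rule group_Mod_free[OF decomp_group_normal[OF N]])
    obtain Q :: "nat monoid" where Q: "group Q" "?G \<cong> Q"
      by (rule countable_group_nat_copy[OF G countable_Mod_free])
    have "finite (carrier ?G)" using triv by simp
    then have "EA Q" using Q iso_finite by (intro EA.finite) auto
    then show False
      using that elementary_amenable_iso[OF _ G group.iso_sym[OF G Q(2)]] elementary_amenable_nat by blast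
  qed
  have "map (\<lambda>i. pick (path i)) [0..<m] = path m" for m
    by (induction m) (simp_all add: path)
  moreover have "path m \<in> decomp_tree \<gamma> l N" for m
    by (induction m) (simp_all only: path decomp_tree.root decomp_tree.extend nontrivial not_ea not_False_eq_True)
  ultimately have "\<forall>m. map (\<lambda>i. pick (path i)) [0..<m] \<in> decomp_tree \<gamma> l N" by simp
  then show False using wf unfolding well_founded_tree_def by blast
qed

lemma decomp_step_embedding:
  assumes N: "N \<lhd> free_grp" "range \<gamma> = carrier free_grp"
  obtains \<iota> where "\<iota> \<in> mon (free_grp Mod decomp_group \<gamma> l N (s @ [n])) (free_grp Mod decomp_group \<gamma> l N s)"
    "\<iota> ` carrier (free_grp Mod decomp_group \<gamma> l N (s @ [n])) =
      S_subgroup (length s + l) ((free_grp Mod decomp_group \<gamma> l N s)\<lparr>carrier :=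
        generated_R \<gamma> (decomp_group \<gamma> l N s) n\<rparr>)"
proof -
  let ?M = "decomp_group \<gamma> l N s"
  let ?H = "generated_R \<gamma> ?M n"
  let ?S = "S_subgroup (length s + l) ((free_grp Mod ?M)\<lparr>carrier := ?H\<rparr>)"
  have M: "?M \<lhd> free_grp" by (rule decomp_group_normal[OF N])
  have G: "group (free_grp Mod ?M)" by (rule group_Mod_free[OF M])
  have H: "subgroup ?H (free_grp Mod ?M)"
    by (rule finitely_generated_subgroup[OF G finitely_generated_R[OF M N(2)]])
  have "?S \<subseteq> ?H"
    using subgroup.subset[OF S_subgroup_subgroup[OF group.subgroup_imp_group[OF G H]]] by simp
  then have S: "?S \<subseteq> carrier (free_grp Mod ?M)" using subgroup.subset[OF H] by blast
  obtain f where "f \<in> iso (free_grp Mod decomp_group \<gamma> l N (s @ [n])) ((free_grp Mod ?M)\<lparr>carrier := ?S\<rparr>)"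
    using marked_S_R_iso[OF M N(2)] unfolding decomp_group_snoc is_iso_def by blast
  then show thesis using S that[of f] by (auto simp: iso_iff mon_def hom_def)
qed

text \<open>Composing the embeddings of the vertex groups into their parents places the whole branch inside
  the group at the root. The generated subgroups are nontrivial because they contain a copy of the
  next vertex group.\<close>

theorem residual_chain_of_infinite_path:
  assumes N: "N \<lhd> free_grp" "range \<gamma> = carrier free_grp"
    and path: "\<And>m. map x [0..<m] \<in> decomp_tree \<gamma> l N"
  obtains F where "residual_chain l (free_grp Mod N) F"
proof -
  define M where "M i = decomp_group \<gamma> l N (map x [0..<i])" for i
  define G where "G i = free_grp Mod M i" for i
  define K where "K i = generated_R \<gamma> (M i) (x i)" for i
  have M: "M i \<lhd> free_grp" for i unfolding M_def by (rule decomp_group_normal[OF N])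
  have G: "group (G i)" for i unfolding G_def by (rule group_Mod_free[OF M])
  have K: "finitely_generated (G i) (K i)" for i
    unfolding G_def K_def by (rule finitely_generated_R[OF M N(2)])
  have Ksub: "subgroup (K i) (G i)" for i by (rule finitely_generated_subgroup[OF G K])
  have nontrivial: "carrier (G i) \<noteq> {\<one>\<^bsub>G i\<^esub>}" for i
  proof -
    have "map x [0..<i] @ [x i] \<in> decomp_tree \<gamma> l N" using path[of "Suc i"] by simp
    then show ?thesis unfolding G_def M_def by (cases rule: decomp_tree.cases) auto
  qed
  have "\<exists>\<iota>. \<iota> \<in> mon (G (Suc i)) (G i) \<and>
      \<iota> ` carrier (G (Suc i)) = S_subgroup (i + l) ((G i)\<lparr>carrier := K i\<rparr>)" for i
    by (rule decomp_step_embedding[OF N, where s = "map x [0..<i]" and n = "x i" and l = l])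
       (auto simp: G_def K_def M_def)
  then obtain \<iota> where \<iota>: "\<And>i. \<iota> i \<in> mon (G (Suc i)) (G i)"
    "\<And>i. \<iota> i ` carrier (G (Suc i)) = S_subgroup (i + l) ((G i)\<lparr>carrier := K i\<rparr>)"
    by metis
  \<comment> \<open>\<open>\<epsilon> i\<close> embeds the \<open>i\<close>-th group of the branch into the group at the root\<close>
  define \<epsilon> where "\<epsilon> = rec_nat id (\<lambda>i e. e \<circ> \<iota> i)"
  have \<epsilon>: "\<epsilon> 0 = id" "\<epsilon> (Suc i) = \<epsilon> i \<circ> \<iota> i" for i by (simp_all add: \<epsilon>_def)
  have mon: "\<epsilon> i \<in> mon (G i) (G 0)" for i
  proof (induction i)
    case 0
    show ?case by (simp add: \<epsilon> mon_def hom_def)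
  next
    case (Suc i)
    show ?case unfolding \<epsilon> by (rule mon_compose[OF \<iota>(1) Suc.IH])
  qed
  have hom: "group_hom (G i) (G 0) (\<epsilon> i)" for i
    using mon G by (auto simp: mon_def intro: group_hom.intro group_hom_axioms.intro)
  have "residual_chain l (G 0) (\<lambda>i. \<epsilon> i ` K i)"
    unfolding residual_chain_def
  proof (intro allI conjI)
    fix i
    show "finitely_generated (G 0) (\<epsilon> i ` K i)" by (rule finitely_generated_image[OF hom K])
    let ?L = "(G i)\<lparr>carrier := K i\<rparr>"
    have S: "S_subgroup (i + l) ?L \<subseteq> K i"
      using subgroup.subset[OF S_subgroup_subgroup[OF group.subgroup_imp_group[OF G Ksub]]] by simp
    show "\<epsilon> i ` K i \<noteq> {\<one>\<^bsub>G 0\<^esub>}"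
    proof
      assume "\<epsilon> i ` K i = {\<one>\<^bsub>G 0\<^esub>}"
      then have "\<epsilon> (Suc i) ` carrier (G (Suc i)) \<subseteq> {\<one>\<^bsub>G 0\<^esub>}"
        using S unfolding \<epsilon> image_comp[symmetric] \<iota>(2) by blast
      then have "y = \<one>\<^bsub>G (Suc i)\<^esub>" if "y \<in> carrier (G (Suc i))" for y
        using that mon[of "Suc i"] unfolding mon_iff_hom_one[OF G G] by (simp add: image_subset_iff)
      then show False
        using nontrivial[of "Suc i"] monoid.one_closed[OF group.is_monoid[OF G[of "Suc i"]]] by blast
    qed
    have "K (Suc i) \<subseteq> carrier (G (Suc i))" by (rule subgroup.subset[OF Ksub])
    then have "\<epsilon> (Suc i) ` K (Suc i) \<subseteq> \<epsilon> i ` S_subgroup (i + l) ?L"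
      unfolding \<epsilon> image_comp[symmetric] \<iota>(2)[symmetric] by (intro image_mono)
    also have "\<dots> \<subseteq> S_subgroup (i + l) ((G 0)\<lparr>carrier := \<epsilon> i ` K i\<rparr>)"
      by (rule S_subgroup_image[OF group_hom.induced_group_hom[OF hom Ksub]]) simp
    finally show "\<epsilon> (Suc i) ` K (Suc i) \<subseteq> S_subgroup (i + l) ((G 0)\<lparr>carrier := \<epsilon> i ` K i\<rparr>)" .
  qed
  moreover have "G 0 = free_grp Mod N" by (simp add: G_def M_def decomp_group_Nil)
  ultimately show thesis using that by simp
qed

theorem theorem6p18:
  fixes \<gamma> :: "nat \<Rightarrow> word" and N :: "word set"
  assumes "range \<gamma> = carrier free_grp"
    and "N \<lhd> free_grp"
  shows "(elementary_amenable (free_grp Mod N) \<longleftrightarrow>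
            (\<forall>l\<ge>1. well_founded_tree (decomp_tree \<gamma> l N))) \<and>
         ((\<forall>l\<ge>1. well_founded_tree (decomp_tree \<gamma> l N)) \<longleftrightarrow>
            (\<exists>l\<ge>1. well_founded_tree (decomp_tree \<gamma> l N)))"
proof -
  have "well_founded_tree (decomp_tree \<gamma> l N)" if "elementary_amenable (free_grp Mod N)" for l
    unfolding well_founded_tree_def
  proof
    assume "\<exists>x. \<forall>m. map x [0..<m] \<in> decomp_tree \<gamma> l N"
    then obtain x where "\<And>m. map x [0..<m] \<in> decomp_tree \<gamma> l N" by blast
    from residual_chain_of_infinite_path[OF assms(2,1) this]
    show False using elementary_amenable_no_residual_chain[OF that] by blast
  qed
  moreover have "elementary_amenable (free_grp Mod N)"
    if "\<exists>l\<ge>1. well_founded_tree (decomp_tree \<gamma> l N)"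
    using that elementary_amenable_of_well_founded[OF assms(2,1)] by blast
  moreover have "\<exists>l::nat. l \<ge> 1" by blast
  ultimately show ?thesis by blast
qed

end
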